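(* Let $\mathsf{PDL}$ be the variety of pseudocomplemented distributive lattices and let $\boldsymbol{F}_{\mathsf{PDL}}(\aleph_0)$ be its free algebra on countably infinitely many free generators. Then the universal theory $\mathsf{Th}_\forall(\boldsymbol{F}_{\mathsf{PDL}}(\aleph_0))$, i.e., the set of all universal sentences valid in $\boldsymbol{F}_{\mathsf{PDL}}(\aleph_0)$, is decidable.
   Context: A pseudocomplemented distributive lattice is an algebra $\langle A;\wedge,\vee,\neg,0,1\rangle$ such that $\langle A;\wedge,\vee,0,1\rangle$ is a bounded distributive lattice and for all $a,b\in A$: $a\leq\neg b$ if and only if $a\wedge b=0$. These algebras form a variety $\mathsf{PDL}$ in the language $\{\wedge,\vee,\neg,0,1\}$. A universal sentence is a first-order sentence of the form $\forall x_1,\dots,x_n\,P$ with $P$ quantifier-free. The free algebra of a variety $\mathsf{V}$ with $\kappa$ free generators is the quotient of the term algebra in variables $\{x_\alpha:\alpha<\kappa\}$ by the congruence identifying terms $t,s$ with $\mathsf{V}\vDash t\approx s$. A set of sentences is decidable when there is an algorithm deciding membership in it. *)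

theory Defs
  imports Main "HOL-Library.Countable_Set" "HOL-Library.Countable" "HOL-Library.Nat_Bijection"
begin

record 'a alg =
  carrier :: "'a set"
  meet :: "'a \<Rightarrow> 'a \<Rightarrow> 'a"
  join :: "'a \<Rightarrow> 'a \<Rightarrow> 'a"
  neg :: "'a \<Rightarrow> 'a"
  zero :: 'a
  one :: 'a

definition leq :: "'a alg \<Rightarrow> 'a \<Rightarrow> 'a \<Rightarrow> bool" where
  "leq A a b \<longleftrightarrow> meet A a b = a"

locale pdl =
  fixes A :: "'a alg"
  assumes meet_closed: "\<lbrakk>a \<in> carrier A; b \<in> carrier A\<rbrakk> \<Longrightarrow> meet A a b \<in> carrier A"
    and join_closed: "\<lbrakk>a \<in> carrier A; b \<in> carrier A\<rbrakk> \<Longrightarrow> join A a b \<in> carrier A"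
    and neg_closed: "a \<in> carrier A \<Longrightarrow> neg A a \<in> carrier A"
    and zero_closed: "zero A \<in> carrier A"
    and one_closed: "one A \<in> carrier A"
    and meet_assoc: "\<lbrakk>a \<in> carrier A; b \<in> carrier A; c \<in> carrier A\<rbrakk>
      \<Longrightarrow> meet A (meet A a b) c = meet A a (meet A b c)"
    and join_assoc: "\<lbrakk>a \<in> carrier A; b \<in> carrier A; c \<in> carrier A\<rbrakk>
      \<Longrightarrow> join A (join A a b) c = join A a (join A b c)"
    and meet_commute: "\<lbrakk>a \<in> carrier A; b \<in> carrier A\<rbrakk> \<Longrightarrow> meet A a b = meet A b a"
    and join_commute: "\<lbrakk>a \<in> carrier A; b \<in> carrier A\<rbrakk> \<Longrightarrow> join A a b = join A b a"
    and meet_absorb: "\<lbrakk>a \<in> carrier A; b \<in> carrier A\<rbrakk> \<Longrightarrow> meet A a (join A a b) = a"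
    and join_absorb: "\<lbrakk>a \<in> carrier A; b \<in> carrier A\<rbrakk> \<Longrightarrow> join A a (meet A a b) = a"
    and distrib: "\<lbrakk>a \<in> carrier A; b \<in> carrier A; c \<in> carrier A\<rbrakk>
      \<Longrightarrow> meet A a (join A b c) = join A (meet A a b) (meet A a c)"
    and zero_least: "a \<in> carrier A \<Longrightarrow> leq A (zero A) a"
    and one_greatest: "a \<in> carrier A \<Longrightarrow> leq A a (one A)"
    and pseudocomplement: "\<lbrakk>a \<in> carrier A; b \<in> carrier A\<rbrakk>
      \<Longrightarrow> leq A a (neg A b) \<longleftrightarrow> meet A a b = zero A"

datatype trm = Var nat | Zero | One | Neg trm | Meet trm trm | Join trm trm

instance trm :: countable
  by countable_datatype

primrec eval :: "'a alg \<Rightarrow> (nat \<Rightarrow> 'a) \<Rightarrow> trm \<Rightarrow> 'a" where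
  "eval A v (Var i) = v i"
| "eval A v Zero = zero A"
| "eval A v One = one A"
| "eval A v (Neg t) = neg A (eval A v t)"
| "eval A v (Meet t s) = meet A (eval A v t) (eval A v s)"
| "eval A v (Join t s) = join A (eval A v t) (eval A v s)"

definition satisfies_identity :: "'a alg \<Rightarrow> trm \<Rightarrow> trm \<Rightarrow> bool" where
  "satisfies_identity A t s \<longleftrightarrow>
     (\<forall>v. range v \<subseteq> carrier A \<longrightarrow> eval A v t = eval A v s)"

text \<open>
  Identities of the variety. HOL cannot quantify over all carrier types at once, so the
  algebras range over those with carrier a subset of \<open>nat\<close>. This is no restriction: by
  \<open>pdl_identity_sound\<close> below, such an identity holds in algebras over every type.
\<close>
definition pdl_identity :: "trm \<Rightarrow> trm \<Rightarrow> bool" where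
  "pdl_identity t s \<longleftrightarrow> (\<forall>A :: nat alg. pdl A \<longrightarrow> satisfies_identity A t s)"

lemma (in pdl) eval_closed: "range v \<subseteq> carrier A \<Longrightarrow> eval A v t \<in> carrier A"
  by (induction t) (auto simp: meet_closed join_closed neg_closed zero_closed one_closed)

lemma pdl_identity_sound:
  fixes A :: "'a alg"
  assumes "pdl A" and "pdl_identity t s"
  shows "satisfies_identity A t s"
  unfolding satisfies_identity_def
proof (intro allI impI)
  interpret pdl A by fact
  fix v :: "nat \<Rightarrow> 'a"
  assume v: "range v \<subseteq> carrier A"
  define B where "B = range (eval A v)"
  define f where "f = to_nat_on B"
  define g where "g = inv_into B f"
  define N where "N = \<lparr>carrier = f ` B, meet = \<lambda>m n. f (meet A (g m) (g n)),
    join = \<lambda>m n. f (join A (g m) (g n)), neg = \<lambda>m. f (neg A (g m)),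
    zero = f (zero A), one = f (one A)\<rparr>"
  have "countable B" by (simp add: B_def)
  then have inj: "inj_on f B" unfolding f_def by (rule inj_on_to_nat_on)
  have gf: "g (f b) = b" if "b \<in> B" for b using that inj by (simp add: g_def)
  have fi: "f a = f b \<longleftrightarrow> a = b" if "a \<in> B" "b \<in> B" for a b using that inj by (auto dest: inj_onD)
  have sub: "a \<in> carrier A" if "a \<in> B" for a using that eval_closed[OF v] by (auto simp: B_def)
  have cl: "zero A \<in> B" "one A \<in> B"
    "a \<in> B \<Longrightarrow> neg A a \<in> B" "a \<in> B \<Longrightarrow> b \<in> B \<Longrightarrow> meet A a b \<in> B"
    "a \<in> B \<Longrightarrow> b \<in> B \<Longrightarrow> join A a b \<in> B" for a b
    unfolding B_def by (auto intro: range_eqI eval.simps[symmetric])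
  have comm: "meet A a b = meet A b a" "join A a b = join A b a" if "a \<in> B" "b \<in> B" for a b
    using that by (simp_all add: sub meet_commute join_commute)
  have "pdl N"
    by unfold_locales
      (auto simp: N_def leq_def gf fi cl sub meet_assoc join_assoc meet_absorb join_absorb distrib
        zero_least[unfolded leq_def] one_greatest[unfolded leq_def]
        pseudocomplement[unfolded leq_def] intro: comm)
  have ev: "eval N (f \<circ> v) r = f (eval A v r)" for r
  proof (induction r)
    case (Var i)
    then show ?case by simp
  qed (simp_all add: N_def gf B_def)
  have "range (f \<circ> v) \<subseteq> carrier N"
    by (auto simp: N_def B_def intro!: imageI range_eqI[of _ _ "Var _"])
  with \<open>pdl N\<close> assms(2) have "f (eval A v t) = f (eval A v s)"
    unfolding pdl_identity_def satisfies_identity_def ev[symmetric] by blast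
  then show "eval A v t = eval A v s" by (simp add: fi B_def)
qed

definition term_cong :: "(trm \<times> trm) set" where
  "term_cong = {(t, s). pdl_identity t s}"

definition free_pdl :: "trm set alg" where
  "free_pdl = \<lparr>
     carrier = UNIV // term_cong,
     meet = \<lambda>X Y. \<Union>t\<in>X. \<Union>s\<in>Y. term_cong `` {Meet t s},
     join = \<lambda>X Y. \<Union>t\<in>X. \<Union>s\<in>Y. term_cong `` {Join t s},
     neg = \<lambda>X. \<Union>t\<in>X. term_cong `` {Neg t},
     zero = term_cong `` {Zero},
     one = term_cong `` {One}\<rparr>"

lemma equiv_term_cong: "equiv UNIV term_cong"
  by (auto simp: equiv_def refl_on_def sym_def trans_def term_cong_def pdl_identity_def
      satisfies_identity_def)

lemma free_pdl_ops:
  "meet free_pdl (term_cong `` {t}) (term_cong `` {s}) = term_cong `` {Meet t s}"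
  "join free_pdl (term_cong `` {t}) (term_cong `` {s}) = term_cong `` {Join t s}"
  "neg free_pdl (term_cong `` {t}) = term_cong `` {Neg t}"
proof -
  have m: "(\<lambda>t s. term_cong `` {Meet t s}) respects2 term_cong"
    and j: "(\<lambda>t s. term_cong `` {Join t s}) respects2 term_cong"
    by (auto simp: congruent2_def term_cong_def pdl_identity_def satisfies_identity_def)
  have n: "(\<lambda>t. term_cong `` {Neg t}) respects term_cong"
    by (auto simp: congruent_def term_cong_def pdl_identity_def satisfies_identity_def)
  show "meet free_pdl (term_cong `` {t}) (term_cong `` {s}) = term_cong `` {Meet t s}"
    using UN_equiv_class2[OF equiv_term_cong equiv_term_cong m] by (simp add: free_pdl_def)
  show "join free_pdl (term_cong `` {t}) (term_cong `` {s}) = term_cong `` {Join t s}"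
    using UN_equiv_class2[OF equiv_term_cong equiv_term_cong j] by (simp add: free_pdl_def)
  show "neg free_pdl (term_cong `` {t}) = term_cong `` {Neg t}"
    using UN_equiv_class[OF equiv_term_cong n] by (simp add: free_pdl_def)
qed

lemma term_class_eq_iff: "term_cong `` {t} = term_cong `` {s} \<longleftrightarrow> pdl_identity t s"
  using eq_equiv_class_iff[OF equiv_term_cong] by (simp add: term_cong_def)

lemma pdl_free_pdl: "pdl free_pdl"
proof -
  have car: "term_cong `` {t} \<in> carrier free_pdl" for t
    by (simp add: free_pdl_def quotientI)
  have carE: "\<exists>t. a = term_cong `` {t}" if "a \<in> carrier free_pdl" for a
    using that by (auto simp: free_pdl_def quotient_def)
  have cst: "zero free_pdl = term_cong `` {Zero}" "one free_pdl = term_cong `` {One}"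
    by (simp_all add: free_pdl_def)
  have idI: "pdl_identity t s"
    if "\<And>(A :: nat alg) v. \<lbrakk>pdl A; range v \<subseteq> carrier A\<rbrakk> \<Longrightarrow> eval A v t = eval A v s" for t s
    using that by (auto simp: pdl_identity_def satisfies_identity_def)
  have pc: "pdl_identity (Meet t (Neg s)) t \<longleftrightarrow> pdl_identity (Meet t s) Zero" for t s
    unfolding pdl_identity_def satisfies_identity_def
    using pdl.pseudocomplement[unfolded leq_def] pdl.eval_closed by fastforce
  have ids:
    "pdl_identity (Meet (Meet t s) r) (Meet t (Meet s r))"
    "pdl_identity (Join (Join t s) r) (Join t (Join s r))"
    "pdl_identity (Meet t s) (Meet s t)"
    "pdl_identity (Join t s) (Join s t)"
    "pdl_identity (Meet t (Join t s)) t"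
    "pdl_identity (Join t (Meet t s)) t"
    "pdl_identity (Meet t (Join s r)) (Join (Meet t s) (Meet t r))"
    "pdl_identity (Meet Zero t) Zero"
    "pdl_identity (Meet t One) t" for t s r
    by (rule idI; simp add: pdl.eval_closed pdl.meet_assoc pdl.join_assoc pdl.meet_absorb
        pdl.join_absorb pdl.distrib pdl.zero_least[unfolded leq_def]
        pdl.one_greatest[unfolded leq_def]; metis pdl.eval_closed pdl.meet_commute pdl.join_commute)+
  show ?thesis
    by unfold_locales
      (clarsimp dest!: carE simp: car cst free_pdl_ops leq_def term_class_eq_iff pc ids)+
qed

datatype fm =
    FEq trm trm
  | FNot fm
  | FAnd fm fm
  | FOr fm fm
  | FImp fm fm
  | FAll nat fm
  | FEx nat fm

primrec sat :: "'a alg \<Rightarrow> (nat \<Rightarrow> 'a) \<Rightarrow> fm \<Rightarrow> bool" where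
  "sat A v (FEq t s) \<longleftrightarrow> eval A v t = eval A v s"
| "sat A v (FNot p) \<longleftrightarrow> \<not> sat A v p"
| "sat A v (FAnd p q) \<longleftrightarrow> sat A v p \<and> sat A v q"
| "sat A v (FOr p q) \<longleftrightarrow> sat A v p \<or> sat A v q"
| "sat A v (FImp p q) \<longleftrightarrow> (sat A v p \<longrightarrow> sat A v q)"
| "sat A v (FAll i p) \<longleftrightarrow> (\<forall>a\<in>carrier A. sat A (v(i := a)) p)"
| "sat A v (FEx i p) \<longleftrightarrow> (\<exists>a\<in>carrier A. sat A (v(i := a)) p)"

definition valid_in :: "'a alg \<Rightarrow> fm \<Rightarrow> bool" where
  "valid_in A p \<longleftrightarrow> (\<forall>v. range v \<subseteq> carrier A \<longrightarrow> sat A v p)"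

primrec trm_vars :: "trm \<Rightarrow> nat set" where
  "trm_vars (Var i) = {i}"
| "trm_vars Zero = {}"
| "trm_vars One = {}"
| "trm_vars (Neg t) = trm_vars t"
| "trm_vars (Meet t s) = trm_vars t \<union> trm_vars s"
| "trm_vars (Join t s) = trm_vars t \<union> trm_vars s"

primrec free_vars :: "fm \<Rightarrow> nat set" where
  "free_vars (FEq t s) = trm_vars t \<union> trm_vars s"
| "free_vars (FNot p) = free_vars p"
| "free_vars (FAnd p q) = free_vars p \<union> free_vars q"
| "free_vars (FOr p q) = free_vars p \<union> free_vars q"
| "free_vars (FImp p q) = free_vars p \<union> free_vars q"
| "free_vars (FAll i p) = free_vars p - {i}"
| "free_vars (FEx i p) = free_vars p - {i}"

definition sentence :: "fm \<Rightarrow> bool" where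
  "sentence p \<longleftrightarrow> free_vars p = {}"

primrec quantifier_free :: "fm \<Rightarrow> bool" where
  "quantifier_free (FEq t s) \<longleftrightarrow> True"
| "quantifier_free (FNot p) \<longleftrightarrow> quantifier_free p"
| "quantifier_free (FAnd p q) \<longleftrightarrow> quantifier_free p \<and> quantifier_free q"
| "quantifier_free (FOr p q) \<longleftrightarrow> quantifier_free p \<and> quantifier_free q"
| "quantifier_free (FImp p q) \<longleftrightarrow> quantifier_free p \<and> quantifier_free q"
| "quantifier_free (FAll i p) \<longleftrightarrow> False"
| "quantifier_free (FEx i p) \<longleftrightarrow> False"

definition universal_sentence :: "fm \<Rightarrow> bool" where
  "universal_sentence p \<longleftrightarrow>
     sentence p \<and> (\<exists>xs q. quantifier_free q \<and> p = foldr FAll xs q)"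

definition universal_theory :: "'a alg \<Rightarrow> fm set" where
  "universal_theory A = {p. universal_sentence p \<and> valid_in A p}"

text \<open>
  \<open>recursive n f\<close>: the function \<open>f\<close>, restricted to argument lists of length \<open>n\<close>, is a
  total recursive function of \<open>n\<close> arguments. Minimization is applied only to regular
  functions, so all functions are total. Values on lists of any other length are junk.
\<close>
inductive recursive :: "nat \<Rightarrow> (nat list \<Rightarrow> nat) \<Rightarrow> bool" where
  rec_zero: "recursive n (\<lambda>xs. 0)"
| rec_succ: "recursive 1 (\<lambda>xs. Suc (xs ! 0))"
| rec_proj: "i < n \<Longrightarrow> recursive n (\<lambda>xs. xs ! i)"
| rec_comp: "\<lbrakk>recursive (length gs) f; \<forall>g\<in>set gs. recursive n g\<rbrakk>
    \<Longrightarrow> recursive n (\<lambda>xs. f (map (\<lambda>g. g xs) gs))"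
| rec_prim: "\<lbrakk>recursive n f; recursive (Suc (Suc n)) g\<rbrakk>
    \<Longrightarrow> recursive (Suc n) (\<lambda>xs. rec_nat (f (tl xs)) (\<lambda>k r. g (k # r # tl xs)) (hd xs))"
| rec_mu: "\<lbrakk>recursive (Suc n) f; \<forall>xs. length xs = n \<longrightarrow> (\<exists>k. f (k # xs) = 0)\<rbrakk>
    \<Longrightarrow> recursive n (\<lambda>xs. LEAST k. f (k # xs) = 0)"

definition recursive_set :: "nat set \<Rightarrow> bool" where
  "recursive_set S \<longleftrightarrow> (\<exists>f. recursive 1 f \<and> (\<forall>x. f [x] = (if x \<in> S then 1 else 0)))"

primrec trm_code :: "trm \<Rightarrow> nat" where
  "trm_code (Var i) = prod_encode (0, i)"
| "trm_code Zero = prod_encode (1, 0)"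
| "trm_code One = prod_encode (2, 0)"
| "trm_code (Neg t) = prod_encode (3, trm_code t)"
| "trm_code (Meet t s) = prod_encode (4, prod_encode (trm_code t, trm_code s))"
| "trm_code (Join t s) = prod_encode (5, prod_encode (trm_code t, trm_code s))"

primrec fm_code :: "fm \<Rightarrow> nat" where
  "fm_code (FEq t s) = prod_encode (0, prod_encode (trm_code t, trm_code s))"
| "fm_code (FNot p) = prod_encode (1, fm_code p)"
| "fm_code (FAnd p q) = prod_encode (2, prod_encode (fm_code p, fm_code q))"
| "fm_code (FOr p q) = prod_encode (3, prod_encode (fm_code p, fm_code q))"
| "fm_code (FImp p q) = prod_encode (4, prod_encode (fm_code p, fm_code q))"
| "fm_code (FAll i p) = prod_encode (5, prod_encode (i, fm_code p))"
| "fm_code (FEx i p) = prod_encode (6, prod_encode (i, fm_code p))"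

lemma inj_trm_code: "inj trm_code"
proof (rule injI)
  show "trm_code t = trm_code s \<Longrightarrow> t = s" for t s
    by (induction t arbitrary: s; case_tac s) auto
qed

lemma inj_fm_code: "inj fm_code"
proof (rule injI)
  show "fm_code p = fm_code q \<Longrightarrow> p = q" for p q
    by (induction p arbitrary: q; case_tac q) (auto dest: injD[OF inj_trm_code])
qed

definition decidable :: "fm set \<Rightarrow> bool" where
  "decidable S \<longleftrightarrow> recursive_set (fm_code ` S)"

end

theory Submission
  imports Defs
begin

text \<open>
  A subdirectly irreducible pseudocomplemented distributive lattice is a Boolean algebra with
  a new top element added. Representing the Boolean algebra by sets gives the following
  description of the free algebra. A \<^emph>\<open>point\<close> is a pair \<open>(V, M)\<close> of a valuation \<open>V\<close> (the set
  of variables that are true) and a nonempty set \<open>M\<close> of valuations, each of which contains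
  \<open>V\<close>. At \<open>(V, M)\<close> the variables are evaluated by \<open>V\<close>, and \<open>\<not>t\<close> is true if \<open>t\<close>, read as a
  Boolean term, is false under every valuation in \<open>M\<close>. Two terms are equal in the variety iff
  they have the same truth value at all points (\<open>pdl_identity_iff_forces\<close>); this is the only
  place where prime filters are needed.

  Ordered by \<open>(V, M) \<sqsubseteq> (V', M')\<close> iff \<open>V \<subseteq> V'\<close> and \<open>M' \<subseteq> M\<close>, the points over finitely many
  variables form the dual space of the free algebra on these variables, with maximal points
  \<open>(U, {U})\<close>; the maximal points above \<open>(V, M)\<close> are those with \<open>U \<in> M\<close>. Terms \<open>\<tau> 0, \<tau> 1, \<dots>\<close>
  substituted for the variables induce a map from points to points, and a quantifier-free
  formula is true in the free algebra under the assignment \<open>\<tau>\<close> iff it holds on the image \<open>Q\<close>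
  of this map, where an equation holds on \<open>Q\<close> if both sides agree at each point of \<open>Q\<close>. If
  only variables below \<open>N\<close> matter, then \<open>Q\<close> is a subset of a fixed finite set, so it remains
  to recognize the sets \<open>Q\<close> that arise as images.

  The condition \<open>realizable\<close> does this. First, for each nonempty set \<open>S\<close> of maximal points of
  \<open>Q\<close> there must be a least element among those members of \<open>Q\<close> that have only maximal points
  from \<open>S\<close> above them, and it must have all of \<open>S\<close> above it. Secondly, for each \<open>x \<in> Q\<close> it
  must be possible to choose, for all nonempty subsets \<open>S\<close> of the maximal points above \<open>x\<close> at
  once, an element above \<open>x\<close> whose maximal points are those in \<open>S\<close>, such that larger sets
  receive smaller elements. Images of the space of points have these properties because that
  space has them in a canonical form (\<open>realizable_pullback\<close>). Conversely, for a realizable \<open>Q\<close>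
  one takes a fresh generator for each pair of a point \<open>w \<in> Q\<close> and a maximal point above \<open>w\<close>.
  Sets of the corresponding singleton valuations form disjoint upward closed regions, one for
  each \<open>w\<close>, and the region of \<open>w\<close> can be mapped to the part of \<open>Q\<close> above \<open>w\<close> independently of
  the others; outside the regions the least elements extend the map. The map is monotone, and
  monotone maps are given by terms, since every upward closed set of points over finitely many
  variables is definable (\<open>realizable_imp_pullback\<close>).

  Consequently a universal sentence with code \<open>c\<close> is valid iff its matrix holds on all
  realizable sets over the variables up to \<open>c\<close>. Finite sets of natural numbers are coded by
  the bits of a natural number, so this is a statement about all numbers below an explicit
  bound, in which all quantifiers are bounded by recursive functions of the earlier variables.
  Truth of a formula and well-formedness are defined by recursion on codes; such
  predicates are recursive because their finite tables of values are again coded by bits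
  (\<open>comp_rel_course_of_values\<close>).
\<close>

section \<open>Truth at points and the identities of the variety\<close>

text \<open>
  The second component decides negations through its maximal points \<open>(U, {U})\<close>. At such a
  point the clauses are those of classical propositional logic for the valuation \<open>U\<close>.
\<close>
primrec forces :: "trm \<Rightarrow> nat set \<times> nat set set \<Rightarrow> bool" where
  "forces (Var i) x \<longleftrightarrow> i \<in> fst x"
| "forces Zero x \<longleftrightarrow> False"
| "forces One x \<longleftrightarrow> True"
| "forces (Neg t) x \<longleftrightarrow> (\<forall>U\<in>snd x. \<not> forces t (U, {U}))"
| "forces (Meet t s) x \<longleftrightarrow> forces t x \<and> forces s x"
| "forces (Join t s) x \<longleftrightarrow> forces t x \<or> forces s x"

definition points :: "(nat set \<times> nat set set) set" where
  "points = {(V, M). M \<noteq> {} \<and> (\<forall>U\<in>M. V \<subseteq> U)}"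

lemma points_iff: "x \<in> points \<longleftrightarrow> snd x \<noteq> {} \<and> (\<forall>U\<in>snd x. fst x \<subseteq> U)"
  by (simp add: points_def split_beta)

lemma points_fst_subset: "x \<in> points \<Longrightarrow> U \<in> snd x \<Longrightarrow> fst x \<subseteq> U"
  by (simp add: points_iff)

lemma maximal_in_points: "(U, {U}) \<in> points"
  by (simp add: points_def)

definition below :: "nat set \<times> nat set set \<Rightarrow> nat set \<times> nat set set \<Rightarrow> bool" (infix "\<sqsubseteq>" 50) where
  "x \<sqsubseteq> y \<longleftrightarrow> fst x \<subseteq> fst y \<and> snd y \<subseteq> snd x"

lemma forces_mono: "x \<sqsubseteq> y \<Longrightarrow> forces t x \<Longrightarrow> forces t y"
  by (induction t) (auto simp: below_def subset_iff)

text \<open>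
  Fixing \<open>M\<close>, the pairs \<open>(a, B)\<close> with \<open>B \<subseteq> M\<close>, and with \<open>a\<close> true only if \<open>B = M\<close>, form the
  powerset algebra of \<open>M\<close> with a new top \<open>(True, M)\<close>. The value of a term there records its
  truth at the point \<open>(V, M)\<close> and the set of \<open>U \<in> M\<close> at which it is classically true.
\<close>
lemma forces_eq_if_pdl_identity:
  assumes "pdl_identity t s" and x: "x \<in> points"
  shows "forces t x \<longleftrightarrow> forces s x"
proof -
  obtain V M where VM: "x = (V, M)" by fastforce
  define A where "A = \<lparr>carrier = {(a, B). B \<subseteq> M \<and> (a \<longrightarrow> B = M)},
    meet = \<lambda>p q. (fst p \<and> fst q, snd p \<inter> snd q), join = \<lambda>p q. (fst p \<or> fst q, snd p \<union> snd q),
    neg = \<lambda>p. (snd p = {}, M - snd p), zero = (False, {}), one = (True, M)\<rparr>"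
  have "M \<noteq> {}" using x VM by (simp add: points_def)
  then have "pdl A"
    by unfold_locales (simp_all add: A_def leq_def split_beta prod_eq_iff, blast+)
  then have id: "satisfies_identity A t s" using assms(1) by (rule pdl_identity_sound)
  define v where "v i = (i \<in> V, {U \<in> M. i \<in> U})" for i
  have "range v \<subseteq> carrier A" using x by (auto simp: v_def A_def VM points_def)
  then have "eval A v t = eval A v s"
    using id unfolding satisfies_identity_def by blast
  moreover have "eval A v r = (forces r (V, M), {U \<in> M. forces r (U, {U})})" for r
    by (induction r) (auto simp: v_def A_def)
  ultimately show ?thesis by (simp add: VM)
qed

section \<open>Prime filters\<close>

context pdl
begin

definition filter_on :: "'a set \<Rightarrow> bool" where
  "filter_on F \<longleftrightarrow> F \<subseteq> carrier A \<and> one A \<in> F \<and> (\<forall>a\<in>F. \<forall>b\<in>F. meet A a b \<in> F) \<and>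
     (\<forall>a\<in>F. \<forall>b\<in>carrier A. leq A a b \<longrightarrow> b \<in> F)"

text \<open>
  With \<open>b\<close> arbitrary this notion separates elements; with \<open>b = zero A\<close> it gives the maximal
  proper filters. One existence proof and one primality proof thus serve both purposes.
\<close>
definition max_avoiding :: "'a \<Rightarrow> 'a set \<Rightarrow> bool" where
  "max_avoiding b F \<longleftrightarrow> filter_on F \<and> b \<notin> F \<and> (\<forall>G. filter_on G \<longrightarrow> F \<subseteq> G \<longrightarrow> b \<notin> G \<longrightarrow> G = F)"

definition prime_filter :: "'a set \<Rightarrow> bool" where
  "prime_filter F \<longleftrightarrow> filter_on F \<and> zero A \<notin> F \<and>
     (\<forall>a\<in>carrier A. \<forall>b\<in>carrier A. join A a b \<in> F \<longrightarrow> a \<in> F \<or> b \<in> F)"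

abbreviation max_filter :: "'a set \<Rightarrow> bool" where
  "max_filter \<equiv> max_avoiding (zero A)"

lemma meet_idem: "a \<in> carrier A \<Longrightarrow> meet A a a = a"
  using meet_absorb[of a "meet A a a"] by (simp add: meet_closed join_absorb)

lemma leq_refl: "a \<in> carrier A \<Longrightarrow> leq A a a"
  by (simp add: leq_def meet_idem)

lemma leq_trans:
  "\<lbrakk>a \<in> carrier A; b \<in> carrier A; c \<in> carrier A; leq A a b; leq A b c\<rbrakk> \<Longrightarrow> leq A a c"
  unfolding leq_def using meet_assoc[of a b c] by simp

lemma meet_leq1: "\<lbrakk>a \<in> carrier A; b \<in> carrier A\<rbrakk> \<Longrightarrow> leq A (meet A a b) a"
  unfolding leq_def
  using meet_assoc[of a a b] meet_commute[of "meet A a b" a] by (simp add: meet_closed meet_idem)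

lemma meet_leq2: "\<lbrakk>a \<in> carrier A; b \<in> carrier A\<rbrakk> \<Longrightarrow> leq A (meet A a b) b"
  using meet_leq1[of b a] meet_commute[of a b] by simp

lemma leq_meet:
  "\<lbrakk>a \<in> carrier A; b \<in> carrier A; c \<in> carrier A; leq A c a; leq A c b\<rbrakk> \<Longrightarrow> leq A c (meet A a b)"
  unfolding leq_def using meet_assoc[of c a b] by simp

lemma meet_mono:
  assumes "a \<in> carrier A" "b \<in> carrier A" "c \<in> carrier A" "d \<in> carrier A" "leq A a c" "leq A b d"
  shows "leq A (meet A a b) (meet A c d)"
proof (rule leq_meet)
  show "leq A (meet A a b) c"
    using assms by (intro leq_trans[OF _ _ _ meet_leq1]) (auto simp: meet_closed)
  show "leq A (meet A a b) d"
    using assms by (intro leq_trans[OF _ _ _ meet_leq2]) (auto simp: meet_closed)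
qed (use assms in \<open>auto simp: meet_closed\<close>)

lemma leq_join1: "\<lbrakk>a \<in> carrier A; b \<in> carrier A\<rbrakk> \<Longrightarrow> leq A a (join A a b)"
  unfolding leq_def by (rule meet_absorb)

lemma leq_join2: "\<lbrakk>a \<in> carrier A; b \<in> carrier A\<rbrakk> \<Longrightarrow> leq A b (join A a b)"
  using leq_join1[of b a] join_commute[of a b] by simp

lemma join_leq:
  "\<lbrakk>a \<in> carrier A; b \<in> carrier A; c \<in> carrier A; leq A a c; leq A b c\<rbrakk> \<Longrightarrow> leq A (join A a b) c"
  unfolding leq_def using distrib[of c a b] meet_commute[of "join A a b" c] meet_commute[of a c]
    meet_commute[of b c] by (simp add: join_closed)

lemma leq_antisym:
  "\<lbrakk>a \<in> carrier A; b \<in> carrier A; leq A a b; leq A b a\<rbrakk> \<Longrightarrow> a = b"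
  unfolding leq_def using meet_commute[of a b] by simp

lemma leq_zero_iff: "a \<in> carrier A \<Longrightarrow> leq A a (zero A) \<longleftrightarrow> a = zero A"
  using leq_antisym zero_closed zero_least leq_refl by blast

lemma filter_onD:
  assumes "filter_on F"
  shows "\<And>a. a \<in> F \<Longrightarrow> a \<in> carrier A" "one A \<in> F"
    "\<And>a b. a \<in> F \<Longrightarrow> b \<in> F \<Longrightarrow> meet A a b \<in> F"
    "\<And>a b. a \<in> F \<Longrightarrow> b \<in> carrier A \<Longrightarrow> leq A a b \<Longrightarrow> b \<in> F"
  using assms unfolding filter_on_def by blast+

lemma principal_filter:
  assumes "a \<in> carrier A"
  shows "filter_on {b \<in> carrier A. leq A a b}"
  unfolding filter_on_def
proof (intro conjI ballI impI)
  show "c \<in> {b \<in> carrier A. leq A a b}"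
    if "b \<in> {b \<in> carrier A. leq A a b}" "c \<in> carrier A" "leq A b c" for b c
    using that leq_trans[OF assms, of b c] by simp
qed (use assms in \<open>auto simp: one_closed one_greatest meet_closed leq_meet\<close>)

text \<open>
  The filter generated by \<open>F\<close> and \<open>c\<close>.
\<close>
definition adjoin :: "'a set \<Rightarrow> 'a \<Rightarrow> 'a set" where
  "adjoin F c = {y \<in> carrier A. \<exists>f\<in>F. leq A (meet A f c) y}"

lemma adjoin_filter:
  assumes F: "filter_on F" and c: "c \<in> carrier A"
  shows "filter_on (adjoin F c)" and "F \<subseteq> adjoin F c" and "c \<in> adjoin F c"
proof -
  note FD = filter_onD[OF F]
  have "meet A y z \<in> adjoin F c" if yzF: "y \<in> adjoin F c" "z \<in> adjoin F c" for y z
  proof -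
    obtain f g where fg: "f \<in> F" "g \<in> F" "leq A (meet A f c) y" "leq A (meet A g c) z"
      and yz: "y \<in> carrier A" "z \<in> carrier A"
      using yzF unfolding adjoin_def by blast
    have fc: "f \<in> carrier A" "g \<in> carrier A" using fg FD(1) by blast+
    let ?h = "meet A (meet A f g) c"
    have h: "?h \<in> carrier A" using fc c by (simp add: meet_closed)
    have "leq A ?h (meet A f c)" "leq A ?h (meet A g c)"
      using fc c by (auto intro!: meet_mono meet_leq1 meet_leq2 leq_refl meet_closed)
    then have "leq A ?h y" "leq A ?h z"
      using leq_trans[OF h _ yz(1) _ fg(3)] leq_trans[OF h _ yz(2) _ fg(4)] fc c
      by (simp_all add: meet_closed)
    then have "leq A ?h (meet A y z)" using h yz by (simp add: leq_meet)
    moreover have "meet A y z \<in> carrier A" using yz by (simp add: meet_closed)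
    ultimately show ?thesis using FD(3)[OF fg(1,2)] unfolding adjoin_def by blast
  qed
  moreover have "one A \<in> adjoin F c"
  proof -
    have "leq A (meet A (one A) c) (one A)" using c by (simp add: one_greatest one_closed meet_closed)
    then show ?thesis using FD(2) one_closed unfolding adjoin_def by blast
  qed
  moreover have "z \<in> adjoin F c" if y: "y \<in> adjoin F c" and z: "z \<in> carrier A" "leq A y z" for y z
  proof -
    obtain f where f: "f \<in> F" "leq A (meet A f c) y" "y \<in> carrier A"
      using y unfolding adjoin_def by blast
    then have "leq A (meet A f c) z"
      using leq_trans[OF _ f(3) z(1) f(2) z(2)] FD(1) c by (simp add: meet_closed)
    then show ?thesis using f(1) z unfolding adjoin_def by blast
  qed
  ultimately show "filter_on (adjoin F c)"
    unfolding filter_on_def by (simp add: adjoin_def subset_iff)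
  show "F \<subseteq> adjoin F c"
    using FD(1) c meet_leq1[OF FD(1) c] unfolding adjoin_def by blast
  show "c \<in> adjoin F c"
    using FD(2) c meet_leq2[OF one_closed c] unfolding adjoin_def by blast
qed

lemma max_avoiding_exists:
  assumes F0: "filter_on F0" and b: "b \<notin> F0"
  shows "\<exists>F. F0 \<subseteq> F \<and> max_avoiding b F"
proof -
  let ?S = "{F. filter_on F \<and> F0 \<subseteq> F \<and> b \<notin> F}"
  have "\<exists>M\<in>?S. \<forall>X\<in>?S. M \<subseteq> X \<longrightarrow> X = M"
  proof (rule subset_Zorn_nonempty)
    show "?S \<noteq> {}" using F0 b by blast
    fix C
    assume "C \<noteq> {}" and C: "subset.chain ?S C"
    have lin: "X \<subseteq> Y \<or> Y \<subseteq> X" if "X \<in> C" "Y \<in> C" for X Y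
      using C that by (auto simp: subset_chain_def)
    have sub: "C \<subseteq> ?S" using C by (auto simp: subset_chain_def)
    have "filter_on (\<Union>C)"
      unfolding filter_on_def
    proof (intro conjI ballI impI)
      show "\<Union>C \<subseteq> carrier A" "one A \<in> \<Union>C"
        using sub \<open>C \<noteq> {}\<close> filter_onD(1,2) by blast+
      show "meet A a c \<in> \<Union>C" if ac: "a \<in> \<Union>C" "c \<in> \<Union>C" for a c
      proof -
        obtain X where "X \<in> C" "a \<in> X" "c \<in> X" using ac lin by blast
        moreover from this sub have "meet A a c \<in> X" using filter_onD(3) by blast
        ultimately show ?thesis by blast
      qed
      show "c \<in> \<Union>C" if "a \<in> \<Union>C" "c \<in> carrier A" "leq A a c" for a c
        using that sub filter_onD(4) by blast
    qed
    then show "\<Union>C \<in> ?S" using sub \<open>C \<noteq> {}\<close> by blast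
  qed
  then obtain F where F: "F \<in> ?S" and max: "\<forall>X\<in>?S. F \<subseteq> X \<longrightarrow> X = F" by (rule bexE)
  have "G = F" if "filter_on G" "F \<subseteq> G" "b \<notin> G" for G
    using F max that by (simp add: subset_trans[of F0 F G])
  then show ?thesis using F unfolding max_avoiding_def by (intro exI[of _ F]) simp
qed

text \<open>
  If \<open>F\<close> contained \<open>c \<or> d\<close> but neither \<open>c\<close> nor \<open>d\<close>, then by maximality adjoining either
  element would produce \<open>b\<close>: \<open>f \<and> c \<le> b\<close> and \<open>g \<and> d \<le> b\<close> with \<open>f, g \<in> F\<close>. Distributivity then
  gives \<open>(f \<and> g) \<and> (c \<or> d) \<le> b\<close>, so \<open>b \<in> F\<close>.
\<close>
lemma max_avoiding_prime:
  assumes F: "max_avoiding b F" and b: "b \<in> carrier A"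
  shows "prime_filter F"
proof -
  have fil: "filter_on F" and bF: "b \<notin> F" using F by (auto simp: max_avoiding_def)
  note FD = filter_onD[OF fil]
  have z: "zero A \<notin> F" using FD(4) b bF zero_least by blast
  have "c \<in> F \<or> d \<in> F" if cd: "c \<in> carrier A" "d \<in> carrier A" "join A c d \<in> F" for c d
  proof (rule ccontr)
    assume neither: "\<not> (c \<in> F \<or> d \<in> F)"
    have "b \<in> adjoin F e" if "e \<in> carrier A" "e \<notin> F" for e
      using adjoin_filter[OF fil that(1)] F that(2) unfolding max_avoiding_def by blast
    then have "b \<in> adjoin F c" "b \<in> adjoin F d" using cd neither by auto
    then obtain f g where fg: "f \<in> F" "leq A (meet A f c) b" "g \<in> F" "leq A (meet A g d) b"
      unfolding adjoin_def by blast
    have fc: "f \<in> carrier A" "g \<in> carrier A" using fg FD(1) by blast+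
    define h where "h = meet A f g"
    have h: "h \<in> carrier A" "h \<in> F" using fc FD(3)[OF fg(1,3)] unfolding h_def by (simp_all add: meet_closed)
    have "leq A (meet A h c) (meet A f c)" "leq A (meet A h d) (meet A g d)"
      using fc cd unfolding h_def by (auto intro!: meet_mono meet_leq1 meet_leq2 leq_refl meet_closed)
    then have "leq A (meet A h c) b" "leq A (meet A h d) b"
      using leq_trans[OF _ _ b _ fg(2), of "meet A h c"] leq_trans[OF _ _ b _ fg(4), of "meet A h d"]
        fc cd h by (simp_all add: meet_closed)
    then have "leq A (join A (meet A h c) (meet A h d)) b"
      using h cd b by (simp add: join_leq meet_closed)
    then have "leq A (meet A h (join A c d)) b" using h cd by (simp add: distrib)
    moreover have "meet A h (join A c d) \<in> F" using FD(3) h cd by blast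
    ultimately show False using FD(4) b bF by blast
  qed
  then show ?thesis using fil z by (auto simp: prime_filter_def)
qed

text \<open>
  Negation is decided by the maximal filters alone, which is why a point has to remember only
  the valuations of the maximal filters above it. If \<open>a\<close> lies in none of them, adjoining \<open>a\<close>
  to \<open>F\<close> yields \<open>zero A\<close>, that is, \<open>f \<and> a = 0\<close> for some \<open>f \<in> F\<close>, and then \<open>f \<le> \<not>a\<close>.
\<close>
lemma neg_in_prime_filter_iff:
  assumes F: "prime_filter F" and a: "a \<in> carrier A"
  shows "neg A a \<in> F \<longleftrightarrow> (\<forall>G. max_filter G \<longrightarrow> F \<subseteq> G \<longrightarrow> a \<notin> G)"
proof (intro iffI allI impI notI)
  fix G
  assume "neg A a \<in> F" and G: "max_filter G" "F \<subseteq> G" and "a \<in> G"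
  then have "meet A (neg A a) a \<in> G" using filter_onD(3) unfolding max_avoiding_def by blast
  moreover have "meet A (neg A a) a = zero A"
    using pseudocomplement[of "neg A a" a] a by (simp add: neg_closed leq_refl)
  ultimately show False using G(1) by (simp add: max_avoiding_def)
next
  assume none: "\<forall>G. max_filter G \<longrightarrow> F \<subseteq> G \<longrightarrow> a \<notin> G"
  have fil: "filter_on F" using F by (simp add: prime_filter_def)
  note FD = filter_onD[OF fil]
  have "zero A \<in> adjoin F a"
  proof (rule ccontr)
    assume "zero A \<notin> adjoin F a"
    then obtain G where "adjoin F a \<subseteq> G" "max_filter G"
      using max_avoiding_exists[OF adjoin_filter(1)[OF fil a]] by blast
    then show False using none adjoin_filter(2,3)[OF fil a] by blast
  qed
  then obtain f where f: "f \<in> F" "leq A (meet A f a) (zero A)" unfolding adjoin_def by blast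
  then have "meet A f a = zero A" using FD(1) a by (simp add: leq_zero_iff meet_closed)
  then have "leq A f (neg A a)" using pseudocomplement[OF FD(1)[OF f(1)] a] by simp
  then show "neg A a \<in> F" using FD(4)[OF f(1) neg_closed[OF a]] by simp
qed

text \<open>
  Above a maximal filter there is no other maximal filter, so its point is a maximal point;
  this is what the clause of \<open>forces\<close> for negation relies on.
\<close>
definition point_of :: "(nat \<Rightarrow> 'a) \<Rightarrow> 'a set \<Rightarrow> nat set \<times> nat set set" where
  "point_of v F = ({i. v i \<in> F}, {{i. v i \<in> G} | G. max_filter G \<and> F \<subseteq> G})"

lemma point_of_in_points:
  assumes "prime_filter F"
  shows "point_of v F \<in> points"
proof -
  have "\<exists>G. F \<subseteq> G \<and> max_filter G"
    using assms max_avoiding_exists by (simp add: prime_filter_def)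
  then show ?thesis by (auto simp: points_def point_of_def)
qed

lemma point_of_max_filter: "max_filter G \<Longrightarrow> point_of v G = ({i. v i \<in> G}, {{i. v i \<in> G}})"
  unfolding point_of_def max_avoiding_def by blast

lemma forces_point_of:
  assumes v: "range v \<subseteq> carrier A" and "prime_filter F"
  shows "forces t (point_of v F) \<longleftrightarrow> eval A v t \<in> F"
  using assms(2)
proof (induction t arbitrary: F)
  case (Var i)
  show ?case by (simp add: point_of_def)
next
  case Zero
  then show ?case by (simp add: prime_filter_def)
next
  case One
  then show ?case by (simp add: prime_filter_def filter_onD)
next
  case (Neg t)
  have "forces (Neg t) (point_of v F) \<longleftrightarrow>
      (\<forall>G. max_filter G \<longrightarrow> F \<subseteq> G \<longrightarrow> \<not> forces t (point_of v G))"
    by (auto simp: point_of_def[of v F] point_of_max_filter)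
  also have "\<dots> \<longleftrightarrow> (\<forall>G. max_filter G \<longrightarrow> F \<subseteq> G \<longrightarrow> eval A v t \<notin> G)"
    using Neg.IH max_avoiding_prime[OF _ zero_closed] by blast
  also have "\<dots> \<longleftrightarrow> neg A (eval A v t) \<in> F"
    using neg_in_prime_filter_iff[OF Neg.prems] eval_closed[OF v] by blast
  finally show ?case by simp
next
  case (Meet t s)
  have fil: "filter_on F" using Meet.prems by (simp add: prime_filter_def)
  have "meet A a b \<in> F \<longleftrightarrow> a \<in> F \<and> b \<in> F" if "a \<in> carrier A" "b \<in> carrier A" for a b
    using filter_onD[OF fil] that meet_leq1 meet_leq2 meet_closed by metis
  then show ?case using Meet eval_closed[OF v] by simp
next
  case (Join t s)
  have fil: "filter_on F" using Join.prems by (simp add: prime_filter_def)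
  have "join A a b \<in> F \<longleftrightarrow> a \<in> F \<or> b \<in> F" if "a \<in> carrier A" "b \<in> carrier A" for a b
    using filter_onD(4)[OF fil] that leq_join1 leq_join2 join_closed Join.prems
    unfolding prime_filter_def by metis
  then show ?case using Join eval_closed[OF v] by simp
qed

lemma eval_leq_if_forces:
  assumes v: "range v \<subseteq> carrier A" and imp: "\<And>x. x \<in> points \<Longrightarrow> forces t x \<Longrightarrow> forces s x"
  shows "leq A (eval A v t) (eval A v s)"
proof (rule ccontr)
  let ?a = "eval A v t" and ?b = "eval A v s"
  assume "\<not> leq A ?a ?b"
  moreover have c: "?a \<in> carrier A" "?b \<in> carrier A" using eval_closed[OF v] by auto
  ultimately obtain F where F: "{b \<in> carrier A. leq A ?a b} \<subseteq> F" "max_avoiding ?b F"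
    using max_avoiding_exists[OF principal_filter[OF c(1)], of ?b] by auto
  have "?a \<in> F" "?b \<notin> F" using F c leq_refl by (auto simp: max_avoiding_def)
  moreover have "prime_filter F" using max_avoiding_prime[OF F(2) c(2)] .
  ultimately show False
    using imp[OF point_of_in_points[of F v]] by (simp add: forces_point_of[OF v])
qed

end

text \<open>
  If \<open>t\<close> fails to be below \<open>s\<close> in some algebra, a prime filter separates their values, and its
  point separates the terms.
\<close>
theorem pdl_identity_iff_forces:
  "pdl_identity t s \<longleftrightarrow> (\<forall>x\<in>points. forces t x \<longleftrightarrow> forces s x)"
proof
  assume eq: "\<forall>x\<in>points. forces t x \<longleftrightarrow> forces s x"
  have "eval A v t = eval A v s" if "pdl A" "range v \<subseteq> carrier A" for A :: "nat alg" and v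
  proof -
    interpret pdl A by fact
    show ?thesis
      using that(2) eq by (intro leq_antisym eval_leq_if_forces eval_closed) simp_all
  qed
  then show "pdl_identity t s"
    by (simp add: pdl_identity_def satisfies_identity_def)
qed (simp add: forces_eq_if_pdl_identity)

section \<open>Assignments in the free algebra as sets of points\<close>

primrec subst :: "(nat \<Rightarrow> trm) \<Rightarrow> trm \<Rightarrow> trm" where
  "subst \<tau> (Var i) = \<tau> i"
| "subst \<tau> Zero = Zero"
| "subst \<tau> One = One"
| "subst \<tau> (Neg t) = Neg (subst \<tau> t)"
| "subst \<tau> (Meet t s) = Meet (subst \<tau> t) (subst \<tau> s)"
| "subst \<tau> (Join t s) = Join (subst \<tau> t) (subst \<tau> s)"

text \<open>
  The map on points dual to the endomorphism of the free algebra that sends the variable \<open>i\<close>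
  to the term \<open>\<tau> i\<close>.
\<close>
definition pullback :: "(nat \<Rightarrow> trm) \<Rightarrow> nat set \<times> nat set set \<Rightarrow> nat set \<times> nat set set" where
  "pullback \<tau> x =
     ({i. forces (\<tau> i) x}, (\<lambda>U. {i. forces (\<tau> i) (U, {U})}) ` snd x)"

lemma forces_subst: "forces (subst \<tau> t) x \<longleftrightarrow> forces t (pullback \<tau> x)"
  by (induction t arbitrary: x) (simp_all add: pullback_def)

lemma eval_free_pdl:
  "eval free_pdl (\<lambda>i. term_cong `` {\<tau> i}) t = term_cong `` {subst \<tau> t}"
proof (induction t)
  case Zero
  show ?case by (simp add: free_pdl_def)
next
  case One
  show ?case by (simp add: free_pdl_def)
qed (simp_all add: free_pdl_ops)

text \<open>
  Quantifiers are skipped: for a sentence with a universal prefix this is the truth of its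
  matrix on \<open>Q\<close>, and the quantification is accounted for by letting \<open>Q\<close> range over all images.
  The clause for \<open>FEx\<close> is a default.
\<close>
primrec holds_on :: "(nat set \<times> nat set set) set \<Rightarrow> fm \<Rightarrow> bool" where
  "holds_on Q (FEq t s) \<longleftrightarrow> (\<forall>x\<in>Q. forces t x \<longleftrightarrow> forces s x)"
| "holds_on Q (FNot p) \<longleftrightarrow> \<not> holds_on Q p"
| "holds_on Q (FAnd p q) \<longleftrightarrow> holds_on Q p \<and> holds_on Q q"
| "holds_on Q (FOr p q) \<longleftrightarrow> holds_on Q p \<or> holds_on Q q"
| "holds_on Q (FImp p q) \<longleftrightarrow> (holds_on Q p \<longrightarrow> holds_on Q q)"
| "holds_on Q (FAll i p) \<longleftrightarrow> holds_on Q p"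
| "holds_on Q (FEx i p) \<longleftrightarrow> holds_on Q p"

lemma sat_free_pdl:
  assumes "quantifier_free p"
  shows "sat free_pdl (\<lambda>i. term_cong `` {\<tau> i}) p \<longleftrightarrow> holds_on (pullback \<tau> ` points) p"
  using assms
  by (induction p)
    (simp_all add: eval_free_pdl term_class_eq_iff pdl_identity_iff_forces forces_subst)

lemma holds_on_foldr [simp]: "holds_on Q (foldr FAll xs p) \<longleftrightarrow> holds_on Q p"
  by (induction xs) auto

lemma valid_in_foldr_FAll: "valid_in A (foldr FAll xs p) \<longleftrightarrow> valid_in A p"
proof (induction xs)
  case (Cons i xs)
  have "valid_in A (FAll i q) \<longleftrightarrow> valid_in A q" for q
  proof
    assume *: "valid_in A (FAll i q)"
    have "sat A v q" if v: "range v \<subseteq> carrier A" for v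
    proof -
      have "\<forall>a\<in>carrier A. sat A (v(i := a)) q" using * v by (simp add: valid_in_def)
      moreover have "v i \<in> carrier A" using v by auto
      ultimately have "sat A (v(i := v i)) q" by (rule bspec)
      then show ?thesis by simp
    qed
    then show "valid_in A q" by (simp add: valid_in_def)
  next
    assume *: "valid_in A q"
    have "range (v(i := a)) \<subseteq> carrier A" if "range v \<subseteq> carrier A" "a \<in> carrier A" for v a
      using that by auto
    then show "valid_in A (FAll i q)" using * by (simp add: valid_in_def)
  qed
  then show ?case using Cons.IH by simp
qed simp

lemma eval_cong: "(\<And>i. i \<in> trm_vars t \<Longrightarrow> v i = w i) \<Longrightarrow> eval A v t = eval A w t"
  by (induction t) auto

lemma sat_cong:
  "quantifier_free p \<Longrightarrow> (\<And>i. i \<in> free_vars p \<Longrightarrow> v i = w i) \<Longrightarrow> sat A v p \<longleftrightarrow> sat A w p"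
proof (induction p)
  case (FEq t s)
  then have "eval A v t = eval A w t" "eval A v s = eval A w s" by (auto intro: eval_cong)
  then show ?case by simp
qed auto

section \<open>The members of \<open>Q\<close> are points, and \<open>Q\<close> contains the maximal points above them. The next
condition provides a least element among the members whose maximal points lie in \<open>S\<close>, and this
element has all of \<open>S\<close> above it. In the last condition, the monotonicity requirement makes \<open>F\<close> the graph of an
order-reversing partial function from sets of maximal points to valuations. It selects, for each nonempty set
\<open>S\<close> of maximal points above \<open>x\<close>, an element of \<open>Q\<close> with exactly these maximal points above it, and since
\<open>F\<close> contains \<open>x\<close>, this element lies above \<open>x\<close>. A separate choice for each \<open>S\<close> would not do, because the
choices must be compatible.\<close>

definition realizable :: "(nat set \<times> nat set set) set \<Rightarrow> bool" where
  "realizable Q \<longleftrightarrow> Q \<noteq> {} \<and>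
     (\<forall>x\<in>Q. x \<in> points \<and> (\<forall>U\<in>snd x. (U, {U}) \<in> Q)) \<and>
     (\<forall>S. S \<noteq> {} \<longrightarrow> (\<forall>U\<in>S. (U, {U}) \<in> Q) \<longrightarrow>
        (\<exists>Z. (Z, S) \<in> Q \<and> (\<forall>x\<in>Q. snd x \<subseteq> S \<longrightarrow> Z \<subseteq> fst x))) \<and>
     (\<forall>x\<in>Q. \<exists>F\<subseteq>Q. x \<in> F \<and> (\<forall>S\<subseteq>snd x. S \<noteq> {} \<longrightarrow> (\<exists>W. (W, S) \<in> F)) \<and>
        (\<forall>a\<in>F. \<forall>b\<in>F. snd a \<subseteq> snd b \<longrightarrow> fst b \<subseteq> fst a))"

lemma pullback_mono: "x \<sqsubseteq> y \<Longrightarrow> pullback \<tau> x \<sqsubseteq> pullback \<tau> y"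
proof -
  assume xy: "x \<sqsubseteq> y"
  then have "{i. forces (\<tau> i) x} \<subseteq> {i. forces (\<tau> i) y}" using forces_mono by blast
  then show ?thesis using xy by (simp add: pullback_def below_def image_mono)
qed

lemma snd_pullback: "snd (pullback \<tau> x) = (\<lambda>U. fst (pullback \<tau> (U, {U}))) ` snd x"
  by (simp add: pullback_def)

lemma fst_pullback_mono: "x \<sqsubseteq> y \<Longrightarrow> fst (pullback \<tau> x) \<subseteq> fst (pullback \<tau> y)"
  using pullback_mono unfolding below_def by blast

text \<open>
  In the full space of points, every nonempty family has a greatest lower bound, with the
  intersection of the first and the union of the second components, and \<open>(\<Inter>S, S)\<close> is the
  largest point with maximal points \<open>S\<close>. The maps \<open>pullback \<tau>\<close> are monotone and map the
  maximal points above \<open>y\<close> onto those above the image of \<open>y\<close>. Therefore it suffices to lift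
  the given members of the image, to take these canonical points, and to map them back.
\<close>
lemma realizable_pullback: "realizable (pullback \<tau> ` points)"
proof -
  let ?Q = "pullback \<tau> ` points"
  define h where "h U = fst (pullback \<tau> (U, {U}))" for U
  have max: "pullback \<tau> (U, {U}) = (h U, {h U})" for U by (simp add: h_def pullback_def)
  have sp: "snd (pullback \<tau> x) = h ` snd x" for x by (simp add: h_def snd_pullback)
  have 1: "?Q \<noteq> {}" using maximal_in_points by blast
  have 2: "x \<in> points \<and> (\<forall>U\<in>snd x. (U, {U}) \<in> ?Q)" if "x \<in> ?Q" for x
  proof -
    obtain y where y: "y \<in> points" "x = pullback \<tau> y" using \<open>x \<in> ?Q\<close> by blast
    have "fst x \<subseteq> h U" if U: "U \<in> snd y" for U
    proof -
      have "y \<sqsubseteq> (U, {U})" using points_fst_subset[OF y(1) U] U by (simp add: below_def)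
      then show ?thesis using fst_pullback_mono y(2) unfolding h_def by blast
    qed
    moreover have "snd y \<noteq> {}" using y(1) by (auto simp: points_def)
    ultimately have "x \<in> points" using sp[of y] y(2) by (simp add: points_iff)
    moreover have "(h U, {h U}) \<in> ?Q" for U
      using maximal_in_points[of U] max[of U] by (metis image_eqI)
    ultimately show ?thesis using sp[of y] y(2) by auto
  qed
  have 3: "\<exists>Z. (Z, S) \<in> ?Q \<and> (\<forall>x\<in>?Q. snd x \<subseteq> S \<longrightarrow> Z \<subseteq> fst x)"
    if S: "S \<noteq> {}" "\<forall>U\<in>S. (U, {U}) \<in> ?Q" for S
  proof -
    \<comment> \<open>A lower bound of all lifts of all members to be bounded.\<close>
    define L where "L = {y \<in> points. snd (pullback \<tau> y) \<subseteq> S}"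
    define y where "y = (\<Inter>(fst ` L), \<Union>(snd ` L))"
    have lift: "\<exists>z\<in>L. snd (pullback \<tau> z) = {U}" if "U \<in> S" for U
    proof -
      have "(U, {U}) \<in> ?Q" using S(2) that by (rule bspec)
      then obtain z where z: "(U, {U}) = pullback \<tau> z" "z \<in> points" by (rule imageE)
      have "snd (pullback \<tau> z) = {U}" unfolding z(1)[symmetric] by simp
      then show ?thesis using z(2) \<open>U \<in> S\<close> by (intro bexI[of _ z]) (auto simp: L_def)
    qed
    have below: "y \<sqsubseteq> z" if "z \<in> L" for z
      using that by (auto simp: y_def below_def)
    have "snd (pullback \<tau> y) = (\<Union>z\<in>L. snd (pullback \<tau> z))"
      by (simp add: sp y_def image_UN)
    also have "\<dots> = S" using lift by (force simp: L_def)
    finally have sy: "snd (pullback \<tau> y) = S" .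
    have "y \<in> points"
    proof -
      have "snd y \<noteq> {}" using sy S(1) sp[of y] by auto
      moreover have "fst y \<subseteq> U" if U: "U \<in> snd y" for U
      proof -
        obtain z where z: "z \<in> L" "U \<in> snd z" using U by (auto simp: y_def)
        then have "fst z \<subseteq> U" using points_fst_subset by (simp add: L_def)
        moreover have "fst y \<subseteq> fst z" using below[OF z(1)] by (simp add: below_def)
        ultimately show ?thesis by simp
      qed
      ultimately show ?thesis by (simp add: points_iff)
    qed
    then have "(fst (pullback \<tau> y), S) \<in> ?Q" using sy by (metis image_eqI prod.collapse)
    moreover have "fst (pullback \<tau> y) \<subseteq> fst x" if x: "x \<in> ?Q" "snd x \<subseteq> S" for x
    proof -
      obtain z where "z \<in> points" "x = pullback \<tau> z" using x(1) by blast
      then show ?thesis using x(2) below[of z] fst_pullback_mono by (simp add: L_def)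
    qed
    ultimately show ?thesis by blast
  qed
  have 4: "\<exists>F\<subseteq>?Q. x \<in> F \<and> (\<forall>S\<subseteq>snd x. S \<noteq> {} \<longrightarrow> (\<exists>W. (W, S) \<in> F)) \<and>
        (\<forall>a\<in>F. \<forall>b\<in>F. snd a \<subseteq> snd b \<longrightarrow> fst b \<subseteq> fst a)" if x: "x \<in> ?Q" for x
  proof -
    obtain y where y: "y \<in> points" "x = pullback \<tau> y" using x by blast
    have "\<forall>U\<in>snd x. \<exists>U'\<in>snd y. h U' = U" using sp[of y] y(2) by auto
    then obtain l where l: "\<And>U. U \<in> snd x \<Longrightarrow> l U \<in> snd y \<and> h (l U) = U" by metis
    \<comment> \<open>For the full set, \<open>y\<close> itself is used so that the family passes through \<open>x\<close>.\<close>
    define z where "z S = (if S = snd x then y else (\<Inter>(l ` S), l ` S))" for S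
    have snd_z: "snd (pullback \<tau> (z S)) = S" if "S \<subseteq> snd x" for S
    proof (cases "S = snd x")
      case False
      have "h ` l ` S = S" using l that by (force simp: image_image)
      then show ?thesis using False by (simp add: sp z_def)
    qed (simp add: z_def y(2))
    have z_points: "z S \<in> points" if "S \<subseteq> snd x" "S \<noteq> {}" for S
      using that y(1) by (auto simp: z_def points_def)
    have z_below: "z S' \<sqsubseteq> z S" if "S \<subseteq> S'" "S' \<subseteq> snd x" for S S'
    proof (cases "S' = snd x \<and> S \<noteq> snd x")
      case True
      have "fst y \<subseteq> l U" if "U \<in> S" for U
      proof -
        have "l U \<in> snd y" using l that \<open>S \<subseteq> S'\<close> \<open>S' \<subseteq> snd x\<close> by blast
        then show ?thesis using points_fst_subset[OF y(1)] by blast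
      qed
      moreover have "l ` S \<subseteq> snd y" using l that by blast
      ultimately show ?thesis using True by (auto simp: z_def below_def)
    next
      case False
      then show ?thesis using that by (auto simp: z_def below_def)
    qed
    define F where "F = (\<lambda>S. pullback \<tau> (z S)) ` {S. S \<subseteq> snd x \<and> S \<noteq> {}}"
    have "snd x \<noteq> {}" using y(1) sp[of y] y(2) by (auto simp: points_def)
    then have xF: "x \<in> F" unfolding F_def by (intro image_eqI[of _ _ "snd x"]) (simp_all add: z_def y(2))
    have FQ: "F \<subseteq> ?Q" using z_points by (auto simp: F_def)
    have ex: "\<exists>W. (W, S) \<in> F" if "S \<subseteq> snd x" "S \<noteq> {}" for S
    proof -
      have "pullback \<tau> (z S) \<in> F" using that by (auto simp: F_def)
      then show ?thesis using snd_z[OF that(1)] by (metis prod.collapse)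
    qed
    have anti: "fst b \<subseteq> fst a" if "a \<in> F" "b \<in> F" "snd a \<subseteq> snd b" for a b
    proof -
      obtain S S' where S: "S \<subseteq> snd x" "S' \<subseteq> snd x" "a = pullback \<tau> (z S)" "b = pullback \<tau> (z S')"
        using \<open>a \<in> F\<close> \<open>b \<in> F\<close> by (auto simp: F_def)
      then have "S \<subseteq> S'" using \<open>snd a \<subseteq> snd b\<close> snd_z by simp
      then show ?thesis using fst_pullback_mono[OF z_below[OF _ S(2)]] S(3,4) by simp
    qed
    show ?thesis
      by (intro exI[of _ F] conjI ballI allI impI) (rule FQ xF ex anti; assumption)+
  qed
  show ?thesis
    unfolding realizable_def
  proof (intro conjI)
    show "\<forall>x\<in>?Q. x \<in> points \<and> (\<forall>U\<in>snd x. (U, {U}) \<in> ?Q)" using 2 by (rule ballI)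
    show "\<forall>S. S \<noteq> {} \<longrightarrow> (\<forall>U\<in>S. (U, {U}) \<in> ?Q) \<longrightarrow>
        (\<exists>Z. (Z, S) \<in> ?Q \<and> (\<forall>x\<in>?Q. snd x \<subseteq> S \<longrightarrow> Z \<subseteq> fst x))"
      by (intro allI impI, rule 3)
    show "\<forall>x\<in>?Q. \<exists>F\<subseteq>?Q. x \<in> F \<and> (\<forall>S\<subseteq>snd x. S \<noteq> {} \<longrightarrow> (\<exists>W. (W, S) \<in> F)) \<and>
        (\<forall>a\<in>F. \<forall>b\<in>F. snd a \<subseteq> snd b \<longrightarrow> fst b \<subseteq> fst a)"
      using 4 by (rule ballI)
  qed (rule 1)
qed

lemma big_meet:
  assumes "finite B"
  shows "\<exists>t. \<forall>x. forces t x \<longleftrightarrow> (\<forall>b\<in>B. forces (f b) x)"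
  using assms
proof (induction B)
  case empty
  show ?case by (rule exI[of _ One]) simp
next
  case (insert b B)
  then obtain t where "\<forall>x. forces t x \<longleftrightarrow> (\<forall>b\<in>B. forces (f b) x)" by blast
  then show ?case by (intro exI[of _ "Meet (f b) t"]) simp
qed

lemma big_join:
  assumes "finite B"
  shows "\<exists>t. \<forall>x. forces t x \<longleftrightarrow> (\<exists>b\<in>B. forces (f b) x)"
  using assms
proof (induction B)
  case empty
  show ?case by (rule exI[of _ Zero]) simp
next
  case (insert b B)
  then obtain t where "\<forall>x. forces t x \<longleftrightarrow> (\<exists>b\<in>B. forces (f b) x)" by blast
  then show ?case by (intro exI[of _ "Join (f b) t"]) simp
qed

definition restrict :: "nat set \<Rightarrow> nat set \<times> nat set set \<Rightarrow> nat set \<times> nat set set" where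
  "restrict I x = (fst x \<inter> I, (\<lambda>U. U \<inter> I) ` snd x)"

definition points_over :: "nat set \<Rightarrow> (nat set \<times> nat set set) set" where
  "points_over I = {x \<in> points. snd x \<subseteq> Pow I}"

lemma restrict_in_points_over: "x \<in> points \<Longrightarrow> restrict I x \<in> points_over I"
  by (force simp: restrict_def points_over_def points_def)

lemma restrict_id: "x \<in> points_over I \<Longrightarrow> restrict I x = x"
proof -
  assume x: "x \<in> points_over I"
  then have "fst x \<subseteq> I" by (fastforce simp: points_over_def points_def)
  moreover have "(\<lambda>U. U \<inter> I) ` snd x = id ` snd x"
    using x by (intro image_cong) (auto simp: points_over_def)
  ultimately show ?thesis by (auto simp: restrict_def prod_eq_iff)
qed

text \<open>
  The condition \<open>V \<subseteq> V'\<close> on \<open>(V', M')\<close> is a meet of variables. For \<open>M' \<subseteq> M\<close>, let \<open>e\<close> be a term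
  that is classically true exactly under the valuations whose restriction to \<open>I\<close> is not in
  \<open>M\<close>; its negation is forced at \<open>(V', M')\<close> iff no valuation in \<open>M'\<close> makes \<open>e\<close> true.
\<close>
lemma cone_definable:
  assumes "finite I" and y: "fst y \<subseteq> I"
  shows "\<exists>t. \<forall>x. forces t x \<longleftrightarrow> y \<sqsubseteq> restrict I x"
proof -
  have "\<exists>t. \<forall>V. forces t (V, {V}) \<longleftrightarrow> V \<inter> I = U" if "U \<subseteq> I" for U
  proof -
    obtain t where t: "\<And>x. forces t x \<longleftrightarrow> (\<forall>i\<in>I. forces (if i \<in> U then Var i else Neg (Var i)) x)"
      using big_meet[OF \<open>finite I\<close>, of "\<lambda>i. if i \<in> U then Var i else Neg (Var i)"] by blast
    have "forces t (V, {V}) \<longleftrightarrow> V \<inter> I = U" for V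
    proof -
      have "forces t (V, {V}) \<longleftrightarrow> (\<forall>i\<in>I. i \<in> U \<longleftrightarrow> i \<in> V)" unfolding t by auto
      also have "\<dots> \<longleftrightarrow> V \<inter> I = U" using that by blast
      finally show ?thesis .
    qed
    then show ?thesis by blast
  qed
  then obtain d where d: "\<And>U V. U \<subseteq> I \<Longrightarrow> forces (d U) (V, {V}) \<longleftrightarrow> V \<inter> I = U" by metis
  have fin: "finite {U. U \<subseteq> I \<and> U \<notin> snd y}" using \<open>finite I\<close> by simp
  obtain e where e: "\<And>x. forces e x \<longleftrightarrow> (\<exists>U\<in>{U. U \<subseteq> I \<and> U \<notin> snd y}. forces (d U) x)"
    using big_join[OF fin, of d] by blast
  have e: "forces e (V, {V}) \<longleftrightarrow> V \<inter> I \<notin> snd y" for V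
    unfolding e using d by (auto simp: Int_absorb1)
  have "finite (fst y)" using y \<open>finite I\<close> by (rule finite_subset)
  then obtain c where c: "\<And>x. forces c x \<longleftrightarrow> (\<forall>i\<in>fst y. forces (Var i) x)"
    using big_meet[of "fst y" Var] by blast
  have "forces (Meet c (Neg e)) x \<longleftrightarrow> y \<sqsubseteq> restrict I x" for x
    using y by (auto simp: c e below_def restrict_def)
  then show ?thesis by blast
qed

text \<open>
  Over finitely many variables, an upward closed set of points is the union of finitely many
  cones.
\<close>
lemma upset_definable:
  assumes I: "finite I"
    and up: "\<And>x y. x \<in> points_over I \<Longrightarrow> y \<in> points_over I \<Longrightarrow> x \<sqsubseteq> y \<Longrightarrow> \<phi> x \<Longrightarrow> \<phi> y"
  shows "\<exists>t. \<forall>x\<in>points. forces t x \<longleftrightarrow> \<phi> (restrict I x)"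
proof -
  have sub: "fst y \<subseteq> I" if "y \<in> points_over I" for y
    using that by (fastforce simp: points_over_def points_def)
  have "points_over I \<subseteq> Pow I \<times> Pow (Pow I)"
  proof
    show "y \<in> Pow I \<times> Pow (Pow I)" if "y \<in> points_over I" for y
      using that sub[OF that] by (simp add: points_over_def mem_Times_iff)
  qed
  then have fin: "finite {y \<in> points_over I. \<phi> y}"
    using I by (auto intro: finite_subset)
  obtain c where c: "\<And>y x. y \<in> points_over I \<Longrightarrow> forces (c y) x \<longleftrightarrow> y \<sqsubseteq> restrict I x"
    using cone_definable[OF I] sub by metis
  obtain t where t: "\<And>x. forces t x \<longleftrightarrow> (\<exists>y\<in>{y \<in> points_over I. \<phi> y}. forces (c y) x)"
    using big_join[OF fin, of c] by blast
  have "forces t x \<longleftrightarrow> \<phi> (restrict I x)" if x: "x \<in> points" for x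
  proof
    assume "forces t x"
    then obtain y where y: "y \<in> points_over I" "\<phi> y" "y \<sqsubseteq> restrict I x" unfolding t using c by auto
    then show "\<phi> (restrict I x)" using up restrict_in_points_over[OF x] by blast
  next
    assume \<phi>: "\<phi> (restrict I x)"
    have r: "restrict I x \<in> points_over I" using x by (rule restrict_in_points_over)
    then have "forces (c (restrict I x)) x" using c by (simp add: below_def)
    then show "forces t x" unfolding t using r \<phi> by (intro bexI[of _ "restrict I x"]) simp_all
  qed
  then show ?thesis by blast
qed

text \<open>
  The set \<open>D\<close> has one element for each pair of a point of \<open>Q\<close> and a maximal point above it,
  and \<open>e\<close> assigns distinct variables to its elements. A valuation that makes only the variable
  of \<open>(w, u)\<close> true is mapped by \<open>\<mu>\<close> to \<open>u\<close>, and every other valuation to an arbitrary fixed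
  maximal point. On points the map is \<open>x \<mapsto> (g x, \<mu> ` snd x)\<close>, where \<open>g\<close> is given by \<open>\<mu>\<close> at
  maximal points; at other points it uses the order-reversing family \<open>W w\<close> if all valuations
  in \<open>snd x\<close> belong to the same \<open>w\<close>, and the least elements \<open>Z\<close> otherwise. Points in a region
  have only points of that region above them, so monotonicity has to be checked only inside a
  region and from outside upwards; the latter holds since \<open>Z\<close> is least.
\<close>
lemma realizable_imp_pullback:
  assumes fin: "finite Q" and Q: "realizable Q"
  shows "\<exists>\<tau>. pullback \<tau> ` points = Q"
proof -
  have ne: "Q \<noteq> {}"
    and pts: "\<And>x. x \<in> Q \<Longrightarrow> x \<in> points"
    and max: "\<And>x U. x \<in> Q \<Longrightarrow> U \<in> snd x \<Longrightarrow> (U, {U}) \<in> Q"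
    using Q unfolding realizable_def by (elim conjE, simp)+
  have "\<forall>S. \<exists>Z. S \<noteq> {} \<longrightarrow> (\<forall>U\<in>S. (U, {U}) \<in> Q) \<longrightarrow>
      (Z, S) \<in> Q \<and> (\<forall>x\<in>Q. snd x \<subseteq> S \<longrightarrow> Z \<subseteq> fst x)"
    using Q unfolding realizable_def by (elim conjE) simp
  from choice[OF this] obtain Z where "\<forall>S. S \<noteq> {} \<longrightarrow> (\<forall>U\<in>S. (U, {U}) \<in> Q) \<longrightarrow>
      (Z S, S) \<in> Q \<and> (\<forall>x\<in>Q. snd x \<subseteq> S \<longrightarrow> Z S \<subseteq> fst x)" ..
  then have Z: "(Z S, S) \<in> Q \<and> (\<forall>x\<in>Q. snd x \<subseteq> S \<longrightarrow> Z S \<subseteq> fst x)"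
    if "S \<noteq> {}" "\<And>U. U \<in> S \<Longrightarrow> (U, {U}) \<in> Q" for S
    using that by simp
  have "\<forall>x\<in>Q. \<exists>F\<subseteq>Q. x \<in> F \<and> (\<forall>S\<subseteq>snd x. S \<noteq> {} \<longrightarrow> (\<exists>W. (W, S) \<in> F)) \<and>
      (\<forall>a\<in>F. \<forall>b\<in>F. snd a \<subseteq> snd b \<longrightarrow> fst b \<subseteq> fst a)"
    using Q unfolding realizable_def by (elim conjE)
  from bchoice[OF this] obtain F where "\<forall>x\<in>Q. F x \<subseteq> Q \<and> x \<in> F x \<and>
      (\<forall>S\<subseteq>snd x. S \<noteq> {} \<longrightarrow> (\<exists>W. (W, S) \<in> F x)) \<and>
      (\<forall>a\<in>F x. \<forall>b\<in>F x. snd a \<subseteq> snd b \<longrightarrow> fst b \<subseteq> fst a)" ..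
  note F = bspec[OF this]
  have F_Q: "F w \<subseteq> Q" if "w \<in> Q" for w using F[OF that] by (elim conjE)
  have F_self: "w \<in> F w" if "w \<in> Q" for w using F[OF that] by (elim conjE)
  have F_ex: "\<exists>W. (W, S) \<in> F w" if "w \<in> Q" "S \<subseteq> snd w" "S \<noteq> {}" for w S
    using F[OF that(1)] that(2,3) by (elim conjE) simp
  have anti: "fst b \<subseteq> fst a" if "w \<in> Q" "a \<in> F w" "b \<in> F w" "snd a \<subseteq> snd b" for w a b
    using F[OF that(1)] that(2-4) by (elim conjE) simp
  define D where "D = Sigma Q snd"
  have "finite (snd x)" if "x \<in> Q" for x
  proof (rule finite_imageD)
    show "finite ((\<lambda>U. (U, {U})) ` snd x)"
      using max[OF that] by (intro finite_subset[OF _ fin]) blast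
  qed (simp add: inj_on_def)
  then have "finite D" using fin by (simp add: D_def)
  then obtain e :: "(nat set \<times> nat set set) \<times> nat set \<Rightarrow> nat" and n where "e ` D = {i. i < n} \<and> inj_on e D"
    using finite_imp_inj_to_nat_seg[OF \<open>finite D\<close>] by (elim exE)
  then have e: "inj_on e D" ..
  define I where "I = e ` D"
  have I: "finite I" using \<open>finite D\<close> by (simp add: I_def)
  obtain w0 where "w0 \<in> Q" using ne by blast
  moreover obtain u0 where "u0 \<in> snd w0" using pts[OF \<open>w0 \<in> Q\<close>] unfolding points_iff by blast
  ultimately have u0: "(u0, {u0}) \<in> Q" by (rule max)
  define \<mu> where "\<mu> U = (if \<exists>d\<in>D. U = {e d} then snd (SOME d. d \<in> D \<and> U = {e d}) else u0)" for U
  have \<mu>_label: "\<mu> {e d} = snd d" if "d \<in> D" for d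
  proof -
    have "(SOME d'. d' \<in> D \<and> {e d} = {e d'}) = d"
      using that e by (intro some_equality) (auto dest: inj_onD)
    then show ?thesis using that by (auto simp: \<mu>_def)
  qed
  have \<mu>_Q: "(\<mu> U, {\<mu> U}) \<in> Q" for U
  proof (cases "\<exists>d\<in>D. U = {e d}")
    case True
    then obtain d where "d \<in> D" "U = {e d}" by blast
    then show ?thesis using \<mu>_label max by (auto simp: D_def)
  next
    case False
    then show ?thesis using u0 by (simp add: \<mu>_def)
  qed
  define region where "region x w \<longleftrightarrow> w \<in> Q \<and> snd x \<subseteq> (\<lambda>u. {e (w, u)}) ` snd w"
    for x :: "nat set \<times> nat set set" and w
  have region_unique: "w = w'" if reg: "region x w" "region x w'" "snd x \<noteq> {}" for x w w'
  proof -
    obtain U where "U \<in> snd x" using reg(3) by blast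
    then have "U \<in> (\<lambda>u. {e (w, u)}) ` snd w" "U \<in> (\<lambda>u. {e (w', u)}) ` snd w'"
      using reg(1,2) by (auto simp: region_def)
    then obtain u u' where "u \<in> snd w" "U = {e (w, u)}" "u' \<in> snd w'" "U = {e (w', u')}"
      by (elim imageE)
    then have "(w, u) = (w', u')"
      using reg(1,2) by (intro inj_onD[OF e]) (simp_all add: D_def region_def)
    then show ?thesis by simp
  qed
  have region_\<mu>: "\<mu> ` snd x \<subseteq> snd w" if "region x w" for x w
  proof -
    have "\<mu> ` snd x \<subseteq> (\<lambda>u. \<mu> {e (w, u)}) ` snd w"
      using that by (auto simp: region_def)
    also have "\<dots> = snd w" using that \<mu>_label by (simp add: region_def D_def)
    finally show ?thesis .
  qed
  define W where "W w S = (SOME W. (W, S) \<in> F w)" for w S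
  have W: "(W w S, S) \<in> F w" if "w \<in> Q" "S \<subseteq> snd w" "S \<noteq> {}" for w S
    unfolding W_def by (rule someI_ex[OF F_ex[OF that]])
  have W_self: "W w (snd w) = fst w" if w: "w \<in> Q" for w
  proof -
    have "snd w \<noteq> {}" using pts[OF w] by (simp add: points_iff)
    then have "(W w (snd w), snd w) \<in> F w" using W[OF w] by simp
    moreover have "w \<in> F w" using w by (rule F_self)
    ultimately show ?thesis
      using anti[OF w, of w "(W w (snd w), snd w)"] anti[OF w, of "(W w (snd w), snd w)" w] by simp
  qed
  define g where "g x = (if \<exists>V. x = (V, {V}) then \<mu> (fst x)
      else if \<exists>w. region x w then W (SOME w. region x w) (\<mu> ` snd x) else Z (\<mu> ` snd x))" for x
  have g_max: "g (V, {V}) = \<mu> V" for V by (simp add: g_def)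
  have g_region: "g x = W w (\<mu> ` snd x)"
    if "region x w" "\<nexists>V. x = (V, {V})" "snd x \<noteq> {}" for x w
  proof -
    have "(SOME w. region x w) = w" using that region_unique by (intro some_equality) blast+
    moreover have "\<exists>w. region x w" using that(1) by (rule exI)
    ultimately show ?thesis using that(2) by (simp only: g_def if_True if_False)
  qed
  have g_Q: "(g x, \<mu> ` snd x) \<in> Q" if x: "x \<in> points" for x
  proof -
    have nex: "snd x \<noteq> {}" using x by (simp add: points_iff)
    consider V where "x = (V, {V})" | w where "region x w" "\<nexists>V. x = (V, {V})"
      | "\<nexists>w. region x w" "\<nexists>V. x = (V, {V})" by blast
    then show ?thesis
    proof cases
      case 1
      then show ?thesis using \<mu>_Q by (simp add: g_max)
    next
      case 2
      have w: "w \<in> Q" using 2(1) by (simp add: region_def)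
      have "(W w (\<mu> ` snd x), \<mu> ` snd x) \<in> F w" using W[OF w region_\<mu>[OF 2(1)]] nex by simp
      then have "(W w (\<mu> ` snd x), \<mu> ` snd x) \<in> Q" using F_Q[OF w] by blast
      then show ?thesis using g_region[OF 2 nex] by simp
    next
      case 3
      then have "g x = Z (\<mu> ` snd x)" by (simp add: g_def)
      moreover have "(Z (\<mu> ` snd x), \<mu> ` snd x) \<in> Q" using Z[of "\<mu> ` snd x"] nex \<mu>_Q by auto
      ultimately show ?thesis by simp
    qed
  qed
  have g_mono: "g x \<subseteq> g y" if x: "x \<in> points" and y: "y \<in> points" and xy: "x \<sqsubseteq> y" for x y
  proof -
    have nex: "snd x \<noteq> {}" and ney: "snd y \<noteq> {}" using x y by (simp_all add: points_iff)
    have sub: "snd y \<subseteq> snd x" using xy by (simp add: below_def)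
    show ?thesis
    proof (cases "\<exists>V. y = (V, {V})")
      case True
      then obtain V where V: "y = (V, {V})" by blast
      have "\<mu> V \<in> \<mu> ` snd x" using sub V by auto
      then have "g x \<subseteq> \<mu> V" using points_fst_subset[OF pts[OF g_Q[OF x]]] by simp
      then show ?thesis using V g_max by simp
    next
      case y_nonmax: False
      have x_nonmax: "\<nexists>V. x = (V, {V})"
      proof
        assume "\<exists>V. x = (V, {V})"
        then obtain V where V: "x = (V, {V})" by blast
        then have "snd y = {V}" using sub ney by auto
        moreover from this have "fst y = V"
          using xy V points_fst_subset[OF y, of V] by (simp add: below_def)
        ultimately show False using y_nonmax by (metis prod.collapse)
      qed
      show ?thesis
      proof (cases "\<exists>w. region x w")
        case True
        then obtain w where w: "region x w" by blast
        then have wQ: "w \<in> Q" and w': "region y w" using sub by (auto simp: region_def)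
        have "W w (\<mu> ` snd x) \<subseteq> W w (\<mu> ` snd y)"
          using anti[OF wQ W[OF wQ region_\<mu>[OF w']] W[OF wQ region_\<mu>[OF w]]] nex ney sub by auto
        then show ?thesis using g_region[OF w x_nonmax nex] g_region[OF w' y_nonmax ney] by simp
      next
        case False
        then have "g x = Z (\<mu> ` snd x)" using x_nonmax by (simp add: g_def)
        moreover have "\<forall>z\<in>Q. snd z \<subseteq> \<mu> ` snd x \<longrightarrow> Z (\<mu> ` snd x) \<subseteq> fst z"
          using Z[of "\<mu> ` snd x"] nex \<mu>_Q by auto
        moreover have "\<mu> ` snd y \<subseteq> \<mu> ` snd x" using sub by (rule image_mono)
        ultimately show ?thesis using g_Q[OF y] by fastforce
      qed
    qed
  qed
  have "\<exists>t. \<forall>x\<in>points. forces t x \<longleftrightarrow> i \<in> g (restrict I x)" for i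
  proof (rule upset_definable[OF I])
    show "i \<in> g y" if "x \<in> points_over I" "y \<in> points_over I" "x \<sqsubseteq> y" "i \<in> g x" for x y
      using that g_mono[of x y] by (auto simp: points_over_def)
  qed
  then have "\<forall>i. \<exists>t. \<forall>x\<in>points. forces t x \<longleftrightarrow> i \<in> g (restrict I x)" ..
  from choice[OF this] obtain \<tau>
    where \<tau>: "\<And>i x. x \<in> points \<Longrightarrow> forces (\<tau> i) x \<longleftrightarrow> i \<in> g (restrict I x)" by blast
  have pb: "pullback \<tau> x = (g (restrict I x), \<mu> ` snd (restrict I x))" if "x \<in> points" for x
  proof -
    have "{i. forces (\<tau> i) (U, {U})} = \<mu> (U \<inter> I)" for U
      using \<tau>[OF maximal_in_points] g_max by (simp add: restrict_def)
    then show ?thesis using \<tau>[OF that] by (simp add: pullback_def restrict_def image_image)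
  qed
  have "pullback \<tau> ` points = Q"
  proof
    show "pullback \<tau> ` points \<subseteq> Q"
    proof (rule image_subsetI)
      fix x
      assume x: "x \<in> points"
      then have "restrict I x \<in> points"
        using restrict_in_points_over[OF x] by (simp add: points_over_def)
      then show "pullback \<tau> x \<in> Q" using pb[OF x] g_Q by simp
    qed
    show "Q \<subseteq> pullback \<tau> ` points"
    proof
      fix w
      assume w: "w \<in> Q"
      \<comment> \<open>The empty valuation keeps \<open>x\<close> from being maximal even if only one maximal point lies above \<open>w\<close>.\<close>
      define x where "x = ({} :: nat set, (\<lambda>u. {e (w, u)}) ` snd w)"
      have new: "snd w \<noteq> {}" using pts[OF w] by (simp add: points_iff)
      then have "x \<in> points_over I" using w by (auto simp: x_def points_over_def points_iff I_def D_def)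
      then have r: "restrict I x = x" and x: "x \<in> points"
        by (simp_all add: restrict_id points_over_def)
      have "region x w" using w by (simp add: region_def x_def)
      moreover have "\<nexists>V. x = (V, {V})" by (auto simp: x_def)
      moreover have nex: "snd x \<noteq> {}" using x by (simp add: points_iff)
      moreover have "\<mu> ` snd x = snd w"
        using \<mu>_label w by (simp add: x_def image_image D_def)
      ultimately have "pullback \<tau> x = w"
        using pb[OF x] r g_region W_self[OF w] by simp
      then show "w \<in> pullback \<tau> ` points" using x by blast
    qed
  qed
  then show ?thesis by blast
qed

lemma free_pdl_valuation: "range (\<lambda>i. term_cong `` {\<tau> i}) \<subseteq> carrier free_pdl"
  by (auto simp: free_pdl_def intro: quotientI)

lemma holds_on_realizable_if_valid:
  assumes "valid_in free_pdl p" and "quantifier_free p" and "finite Q" and "realizable Q"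
  shows "holds_on Q p"
proof -
  obtain \<tau> where "pullback \<tau> ` points = Q" using realizable_imp_pullback assms by blast
  moreover have "sat free_pdl (\<lambda>i. term_cong `` {\<tau> i}) p"
    using assms(1) free_pdl_valuation[of \<tau>] unfolding valid_in_def by simp
  ultimately show ?thesis using sat_free_pdl[OF assms(2)] by simp
qed

text \<open>
  Variables from \<open>N\<close> on may be assigned \<open>Zero\<close>, which keeps the image within subsets of
  \<open>{..<N}\<close>.
\<close>
lemma valid_if_holds_on_realizable:
  assumes qf: "quantifier_free p" and N: "free_vars p \<subseteq> {..<N}"
    and holds: "\<And>Q. realizable Q \<Longrightarrow> Q \<subseteq> Pow {..<N} \<times> Pow (Pow {..<N}) \<Longrightarrow> holds_on Q p"
  shows "valid_in free_pdl p"
  unfolding valid_in_def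
proof (intro allI impI)
  fix v :: "nat \<Rightarrow> trm set"
  assume v: "range v \<subseteq> carrier free_pdl"
  have "\<exists>t. v i = term_cong `` {t}" for i
  proof -
    have "v i \<in> UNIV // term_cong" using v by (auto simp: free_pdl_def)
    then show ?thesis by (auto simp: quotient_def)
  qed
  then obtain r where r: "\<And>i. v i = term_cong `` {r i}" by metis
  define \<tau> where "\<tau> i = (if i < N then r i else Zero)" for i
  have "pullback \<tau> x \<in> Pow {..<N} \<times> Pow (Pow {..<N})" for x
  proof -
    have "{i. forces (\<tau> i) y} \<subseteq> {..<N}" for y by (auto simp: \<tau>_def split: if_splits)
    then show ?thesis by (auto simp: pullback_def)
  qed
  then have "holds_on (pullback \<tau> ` points) p"
    by (intro holds realizable_pullback image_subsetI)
  then have "sat free_pdl (\<lambda>i. term_cong `` {\<tau> i}) p" using sat_free_pdl[OF qf] by simp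
  moreover have "v i = term_cong `` {\<tau> i}" if "i \<in> free_vars p" for i
    using that N r by (auto simp: \<tau>_def)
  ultimately show "sat free_pdl v p" using sat_cong[OF qf, of v] by simp
qed

section \<open>Closure properties of recursive functions and relations\<close>

named_theorems computability

text \<open>
  The values of a recursive function on lists of other lengths depend on how it was derived.
  Comparing functions only on lists of length \<open>n\<close> makes the notion invariant under equality on
  the meaningful arguments. In the closure properties below, a list of arguments is accessed
  through \<open>hd\<close> and \<open>tl\<close>, so that a bounded variable is the head of a longer list and the rules
  apply to a formula by following its syntax.
\<close>
definition comp_fun :: "nat \<Rightarrow> (nat list \<Rightarrow> nat) \<Rightarrow> bool" where
  "comp_fun n f \<longleftrightarrow> (\<exists>g. recursive n g \<and> (\<forall>xs. length xs = n \<longrightarrow> g xs = f xs))"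

definition comp_rel :: "nat \<Rightarrow> (nat list \<Rightarrow> bool) \<Rightarrow> bool" where
  "comp_rel n P \<longleftrightarrow> comp_fun n (\<lambda>xs. if P xs then 1 else 0)"

lemma comp_fun_cong:
  assumes "comp_fun n f" and "\<And>xs. length xs = n \<Longrightarrow> f xs = g xs"
  shows "comp_fun n g"
  using assms unfolding comp_fun_def by auto

lemma comp_rel_cong:
  assumes "comp_rel n P" and "\<And>xs. length xs = n \<Longrightarrow> P xs \<longleftrightarrow> Q xs"
  shows "comp_rel n Q"
  using assms(1) unfolding comp_rel_def by (rule comp_fun_cong) (simp add: assms(2))

lemma comp_fun_compose:
  assumes f: "comp_fun (length gs) f" and gs: "\<forall>g\<in>set gs. comp_fun n g"
  shows "comp_fun n (\<lambda>xs. f (map (\<lambda>g. g xs) gs))"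
proof -
  obtain f' where f': "recursive (length gs) f'" "\<And>xs. length xs = length gs \<Longrightarrow> f' xs = f xs"
    using f unfolding comp_fun_def by blast
  obtain r where r: "\<forall>g\<in>set gs. recursive n (r g) \<and> (\<forall>xs. length xs = n \<longrightarrow> r g xs = g xs)"
    using gs unfolding comp_fun_def by metis
  have "recursive n (\<lambda>xs. f' (map (\<lambda>g. g xs) (map r gs)))"
    using f'(1) r by (intro rec_comp) auto
  moreover have "f' (map (\<lambda>g. g xs) (map r gs)) = f (map (\<lambda>g. g xs) gs)" if "length xs = n" for xs
  proof -
    have "map (\<lambda>g. g xs) (map r gs) = map (\<lambda>g. g xs) gs" using r that by simp
    then show ?thesis using f'(2)[of "map (\<lambda>g. g xs) gs"] by (simp only:) simp
  qed
  ultimately show ?thesis unfolding comp_fun_def by blast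
qed

lemma comp_fun_nth: "i < n \<Longrightarrow> comp_fun n (\<lambda>xs. xs ! i)"
  unfolding comp_fun_def using rec_proj by blast

lemma comp_fun_hd [computability]: "comp_fun (Suc n) (\<lambda>xs. hd xs)"
  by (rule comp_fun_cong[OF comp_fun_nth[of 0]]) (auto simp: length_Suc_conv)

lemma comp_fun_tl [computability]:
  assumes "comp_fun n f"
  shows "comp_fun (Suc n) (\<lambda>xs. f (tl xs))"
proof -
  let ?gs = "map (\<lambda>i xs. xs ! Suc i) [0..<n]"
  have "comp_fun (Suc n) (\<lambda>xs. f (map (\<lambda>g. g xs) ?gs))"
    using assms by (intro comp_fun_compose) (auto intro: comp_fun_nth)
  moreover have "map (\<lambda>g. g xs) ?gs = tl xs" if "length xs = Suc n" for xs :: "nat list"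
    using that by (intro nth_equalityI) (auto simp: nth_tl)
  ultimately show ?thesis by (auto intro: comp_fun_cong)
qed

text \<open>
  In a primitive recursion the step function receives the counter, the previous value and the
  parameters; this makes a function of counter and parameters into such a step function.
\<close>
lemma comp_fun_skip:
  assumes "comp_fun (Suc n) (\<lambda>ys. F (hd ys) (tl ys))"
  shows "comp_fun (Suc (Suc n)) (\<lambda>ys. F (hd ys) (tl (tl ys)))"
proof -
  let ?gs = "map (\<lambda>i ys. ys ! Suc (Suc i)) [0..<n]"
  have "comp_fun (Suc (Suc n)) (\<lambda>ys. (\<lambda>ys. F (hd ys) (tl ys)) (map (\<lambda>g. g ys) (hd # ?gs)))"
    using assms by (intro comp_fun_compose) (auto intro: comp_fun_nth comp_fun_hd)
  moreover have "map (\<lambda>g. g ys) ?gs = tl (tl ys)" if "length ys = Suc (Suc n)" for ys :: "nat list"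
    using that by (intro nth_equalityI) (auto simp: nth_tl)
  ultimately show ?thesis by (auto intro: comp_fun_cong)
qed

lemma comp_fun_subst1:
  assumes "comp_fun (Suc 0) (\<lambda>xs. F (hd xs))" and "comp_fun n f"
  shows "comp_fun n (\<lambda>xs. F (f xs))"
  using comp_fun_compose[of "[f]" "\<lambda>xs. F (hd xs)" n] assms by simp

lemma comp_rel_subst1:
  assumes "comp_rel (Suc 0) (\<lambda>xs. P (hd xs))" and "comp_fun n f"
  shows "comp_rel n (\<lambda>xs. P (f xs))"
  using comp_fun_compose[of "[f]" "\<lambda>xs. if P (hd xs) then 1 else 0" n] assms
  by (simp add: comp_rel_def)

lemma comp_rel_subst3:
  assumes "comp_rel (Suc (Suc (Suc 0))) (\<lambda>xs. P (hd xs) (hd (tl xs)) (hd (tl (tl xs))))"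
    and "comp_fun n f" "comp_fun n g" "comp_fun n h"
  shows "comp_rel n (\<lambda>xs. P (f xs) (g xs) (h xs))"
  using comp_fun_compose[of "[f, g, h]"
      "\<lambda>xs. if P (hd xs) (hd (tl xs)) (hd (tl (tl xs))) then 1 else 0" n] assms
  by (simp add: comp_rel_def)

lemma comp_rel_subst4:
  assumes "comp_rel (Suc (Suc (Suc (Suc 0))))
      (\<lambda>xs. P (hd xs) (hd (tl xs)) (hd (tl (tl xs))) (hd (tl (tl (tl xs)))))"
    and "comp_fun n f" "comp_fun n g" "comp_fun n h" "comp_fun n k"
  shows "comp_rel n (\<lambda>xs. P (f xs) (g xs) (h xs) (k xs))"
  using comp_fun_compose[of "[f, g, h, k]"
      "\<lambda>xs. if P (hd xs) (hd (tl xs)) (hd (tl (tl xs))) (hd (tl (tl (tl xs)))) then 1 else 0" n] assms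
  by (simp add: comp_rel_def)

lemma comp_fun_Suc [computability]:
  assumes "comp_fun n f"
  shows "comp_fun n (\<lambda>xs. Suc (f xs))"
proof -
  have "comp_fun 1 (\<lambda>xs. Suc (xs ! 0))" unfolding comp_fun_def using rec_succ by blast
  then have "comp_fun (Suc 0) (\<lambda>xs. Suc (hd xs))"
    unfolding One_nat_def by (rule comp_fun_cong) (auto simp: length_Suc_conv)
  then show ?thesis using assms by (rule comp_fun_subst1)
qed

lemma comp_fun_const [computability]: "comp_fun n (\<lambda>xs. k)"
proof (induction k)
  case 0
  show ?case unfolding comp_fun_def using rec_zero by blast
next
  case (Suc k)
  then show ?case by (rule comp_fun_Suc)
qed

lemma comp_fun_rec_nat:
  assumes f: "comp_fun n f"
    and g: "comp_fun (Suc (Suc n)) (\<lambda>ys. g (hd ys) (hd (tl ys)) (tl (tl ys)))"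
    and h: "comp_fun n h"
  shows "comp_fun n (\<lambda>xs. rec_nat (f xs) (\<lambda>k r. g k r xs) (h xs))"
proof -
  obtain f' where f': "recursive n f'" "\<And>xs. length xs = n \<Longrightarrow> f' xs = f xs"
    using f unfolding comp_fun_def by blast
  obtain g' where g': "recursive (Suc (Suc n)) g'"
    "\<And>xs. length xs = Suc (Suc n) \<Longrightarrow> g' xs = g (hd xs) (hd (tl xs)) (tl (tl xs))"
    using g unfolding comp_fun_def by blast
  let ?R = "\<lambda>xs. rec_nat (f (tl xs)) (\<lambda>k r. g k r (tl xs)) (hd xs)"
  have "comp_fun (Suc n) ?R"
    unfolding comp_fun_def
  proof (intro exI conjI allI impI)
    show "recursive (Suc n) (\<lambda>xs. rec_nat (f' (tl xs)) (\<lambda>k r. g' (k # r # tl xs)) (hd xs))"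
      using f'(1) g'(1) by (rule rec_prim)
  qed (simp add: f'(2) g'(2))
  moreover have "\<forall>k\<in>set (map (\<lambda>i xs. xs ! i) [0..<n]). comp_fun n k" by (auto intro: comp_fun_nth)
  ultimately have "comp_fun n (\<lambda>xs. ?R (map (\<lambda>g. g xs) (h # map (\<lambda>i xs. xs ! i) [0..<n])))"
    using h by (intro comp_fun_compose) auto
  then show ?thesis
  proof (rule comp_fun_cong)
    fix xs :: "nat list"
    assume "length xs = n"
    then have "map (\<lambda>g. g xs) (map (\<lambda>i xs. xs ! i) [0..<n]) = xs"
      by (intro nth_equalityI) auto
    then show "?R (map (\<lambda>g. g xs) (h # map (\<lambda>i xs. xs ! i) [0..<n])) =
        rec_nat (f xs) (\<lambda>k r. g k r xs) (h xs)"
      by simp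
  qed
qed

lemma comp_fun_add [computability]:
  assumes "comp_fun n f" "comp_fun n g"
  shows "comp_fun n (\<lambda>xs. f xs + g xs)"
proof -
  have "rec_nat a (\<lambda>k r. Suc r) b = a + b" for a b :: nat by (induction b) auto
  moreover have "comp_fun n (\<lambda>xs. rec_nat (f xs) (\<lambda>k r. Suc r) (g xs))"
    by (intro comp_fun_rec_nat computability assms)
  ultimately show ?thesis by simp
qed

lemma comp_fun_mult [computability]:
  assumes "comp_fun n f" "comp_fun n g"
  shows "comp_fun n (\<lambda>xs. f xs * g xs)"
proof -
  have "rec_nat 0 (\<lambda>k r. r + a) b = a * b" for a b :: nat by (induction b) auto
  moreover have "comp_fun n (\<lambda>xs. rec_nat 0 (\<lambda>k r. r + f xs) (g xs))"
    by (intro comp_fun_rec_nat computability assms)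
  ultimately show ?thesis by simp
qed

lemma comp_fun_power [computability]:
  assumes "comp_fun n f" "comp_fun n g"
  shows "comp_fun n (\<lambda>xs. f xs ^ g xs)"
proof -
  have "rec_nat 1 (\<lambda>k r. r * a) b = a ^ b" for a b :: nat by (induction b) auto
  moreover have "comp_fun n (\<lambda>xs. rec_nat 1 (\<lambda>k r. r * f xs) (g xs))"
    by (intro comp_fun_rec_nat computability assms)
  ultimately show ?thesis by simp
qed

lemma comp_fun_diff [computability]:
  assumes "comp_fun n f" "comp_fun n g"
  shows "comp_fun n (\<lambda>xs. f xs - g xs)"
proof -
  have "rec_nat 0 (\<lambda>k r. k) b = b - 1" for b :: nat by (cases b) auto
  moreover have "comp_fun (Suc 0) (\<lambda>xs. rec_nat 0 (\<lambda>k r. k) (hd xs))"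
    by (intro comp_fun_rec_nat computability)
  ultimately have pred: "comp_fun (Suc 0) (\<lambda>xs. hd xs - 1)" by simp
  have "rec_nat a (\<lambda>k r. r - 1) b = a - b" for a b :: nat by (induction b) auto
  moreover have "comp_fun n (\<lambda>xs. rec_nat (f xs) (\<lambda>k r. r - 1) (g xs))"
    by (intro comp_fun_rec_nat comp_fun_subst1[OF pred] computability assms)
  ultimately show ?thesis by simp
qed

lemma comp_rel_not [computability]: "comp_rel n P \<Longrightarrow> comp_rel n (\<lambda>xs. \<not> P xs)"
  unfolding comp_rel_def
  by (rule comp_fun_cong[OF comp_fun_diff[OF comp_fun_const[of n 1]]]) auto

lemma comp_rel_conj [computability]:
  "comp_rel n P \<Longrightarrow> comp_rel n Q \<Longrightarrow> comp_rel n (\<lambda>xs. P xs \<and> Q xs)"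
  unfolding comp_rel_def by (drule (1) comp_fun_mult, erule comp_fun_cong) auto

lemma comp_rel_disj [computability]:
  "comp_rel n P \<Longrightarrow> comp_rel n Q \<Longrightarrow> comp_rel n (\<lambda>xs. P xs \<or> Q xs)"
  by (rule comp_rel_cong[of n "\<lambda>xs. \<not> (\<not> P xs \<and> \<not> Q xs)"], intro computability) auto

lemma comp_rel_imp [computability]:
  "comp_rel n P \<Longrightarrow> comp_rel n Q \<Longrightarrow> comp_rel n (\<lambda>xs. P xs \<longrightarrow> Q xs)"
  by (rule comp_rel_cong[of n "\<lambda>xs. \<not> P xs \<or> Q xs"], intro computability) auto

lemma comp_rel_iff [computability]:
  "comp_rel n P \<Longrightarrow> comp_rel n Q \<Longrightarrow> comp_rel n (\<lambda>xs. P xs \<longleftrightarrow> Q xs)"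
  by (rule comp_rel_cong[of n "\<lambda>xs. (P xs \<longrightarrow> Q xs) \<and> (Q xs \<longrightarrow> P xs)"],
      intro computability) auto

lemma comp_rel_less [computability]:
  assumes "comp_fun n f" "comp_fun n g"
  shows "comp_rel n (\<lambda>xs. f xs < g xs)"
proof -
  have "comp_fun n (\<lambda>xs. 1 - (1 - (g xs - f xs)))" by (intro computability assms)
  then show ?thesis unfolding comp_rel_def by (rule comp_fun_cong) auto
qed

lemma comp_rel_eq [computability]:
  assumes "comp_fun n f" "comp_fun n g"
  shows "comp_rel n (\<lambda>xs. f xs = g xs)"
proof -
  have "comp_rel n (\<lambda>xs. \<not> f xs < g xs \<and> \<not> g xs < f xs)" by (intro computability assms)
  then show ?thesis by (rule comp_rel_cong) auto
qed

lemma comp_rel_bex [computability]: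
  assumes "comp_fun n f" and "comp_rel (Suc n) (\<lambda>ys. P (hd ys) (tl ys))"
  shows "comp_rel n (\<lambda>xs. \<exists>i<f xs. P i xs)"
proof -
  define S where "S b xs = rec_nat 0 (\<lambda>k r. r + (if P k xs then 1 else 0 :: nat)) b" for b xs
  have S: "0 < S b xs \<longleftrightarrow> (\<exists>i<b. P i xs)" for b xs
    by (induction b) (simp_all add: S_def less_Suc_eq ex_disj_distrib conj_disj_distribR)
  have "comp_fun (Suc n) (\<lambda>ys. if P (hd ys) (tl ys) then 1 else 0)"
    using assms(2) unfolding comp_rel_def .
  note step = comp_fun_skip[OF this]
  have "comp_fun n (\<lambda>xs. S (f xs) xs)"
    unfolding S_def by (intro comp_fun_rec_nat comp_fun_add step computability assms)
  then have "comp_rel n (\<lambda>xs. 0 < S (f xs) xs)" by (intro computability)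
  then show ?thesis by (simp add: S)
qed

lemma comp_rel_ball [computability]:
  assumes "comp_fun n f" and "comp_rel (Suc n) (\<lambda>ys. P (hd ys) (tl ys))"
  shows "comp_rel n (\<lambda>xs. \<forall>i<f xs. P i xs)"
proof -
  have "comp_rel n (\<lambda>xs. \<not> (\<exists>i<f xs. \<not> P i xs))"
    using assms by (intro comp_rel_not comp_rel_bex)
  then show ?thesis by (rule comp_rel_cong) auto
qed

lemma comp_fun_Least:
  assumes P: "comp_rel (Suc n) (\<lambda>ys. P (hd ys) (tl ys))"
    and ex: "\<And>xs. length xs = n \<Longrightarrow> \<exists>k. P k xs"
  shows "comp_fun n (\<lambda>xs. LEAST k. P k xs)"
proof -
  obtain f where f: "recursive (Suc n) f"
    "\<And>ys. length ys = Suc n \<Longrightarrow> f ys = (if \<not> P (hd ys) (tl ys) then 1 else 0)"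
    using comp_rel_not[OF P] unfolding comp_rel_def comp_fun_def by blast
  have "recursive n (\<lambda>xs. LEAST k. f (k # xs) = 0)"
    using f(1) ex by (intro rec_mu) (auto simp: f(2))
  moreover have "(LEAST k. f (k # xs) = 0) = (LEAST k. P k xs)" if "length xs = n" for xs
    using that by (simp add: f(2))
  ultimately show ?thesis unfolding comp_fun_def by blast
qed

lemma comp_fun_prod_encode [computability]:
  assumes "comp_fun n f" "comp_fun n g"
  shows "comp_fun n (\<lambda>xs. prod_encode (f xs, g xs))"
proof -
  have "rec_nat 0 (\<lambda>k r. r + Suc k) b = triangle b" for b by (induction b) auto
  moreover have "comp_fun (Suc 0) (\<lambda>xs. rec_nat 0 (\<lambda>k r. r + Suc k) (hd xs))"
    by (intro comp_fun_rec_nat computability)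
  ultimately have t: "comp_fun (Suc 0) (\<lambda>xs. triangle (hd xs))" by simp
  have "comp_fun n (\<lambda>xs. triangle (f xs + g xs) + f xs)"
    by (intro comp_fun_add comp_fun_subst1[OF t] assms)
  then show ?thesis by (simp add: prod_encode_def)
qed

abbreviation pfst :: "nat \<Rightarrow> nat" where "pfst n \<equiv> fst (prod_decode n)"
abbreviation psnd :: "nat \<Rightarrow> nat" where "psnd n \<equiv> snd (prod_decode n)"

lemma prod_decode_eqI: "prod_encode (a, b) = p \<Longrightarrow> prod_decode p = (a, b)"
  by auto

lemma pfst_le: "pfst n \<le> n" and psnd_le: "psnd n \<le> n"
  using le_prod_encode_1[of "pfst n" "psnd n"] le_prod_encode_2[of "psnd n" "pfst n"] by auto

lemma comp_fun_pfst [computability]: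
  assumes "comp_fun n f"
  shows "comp_fun n (\<lambda>xs. pfst (f xs))"
proof -
  have "(LEAST a. \<exists>b<Suc p. prod_encode (a, b) = p) = pfst p" for p
    by (rule Least_equality)
      (auto simp: less_Suc_eq_le psnd_le intro!: exI[of _ "psnd p"] dest: prod_decode_eqI)
  moreover have "comp_fun (Suc 0) (\<lambda>xs. LEAST a. \<exists>b<Suc (hd xs). prod_encode (a, b) = hd xs)"
  proof (rule comp_fun_Least)
    show "comp_rel (Suc (Suc 0)) (\<lambda>ys. \<exists>b<Suc (hd (tl ys)). prod_encode (hd ys, b) = hd (tl ys))"
      by (intro computability)
    show "\<exists>a. \<exists>b<Suc (hd xs). prod_encode (a, b) = hd xs" for xs
      by (metis less_Suc_eq_le prod.collapse prod_decode_inverse psnd_le)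
  qed
  ultimately have "comp_fun (Suc 0) (\<lambda>xs. pfst (hd xs))" by simp
  then show ?thesis using assms by (rule comp_fun_subst1)
qed

lemma comp_fun_psnd [computability]:
  assumes "comp_fun n f"
  shows "comp_fun n (\<lambda>xs. psnd (f xs))"
proof -
  have "(LEAST b. \<exists>a<Suc p. prod_encode (a, b) = p) = psnd p" for p
    by (rule Least_equality)
      (auto simp: less_Suc_eq_le pfst_le intro!: exI[of _ "pfst p"] dest: prod_decode_eqI)
  moreover have "comp_fun (Suc 0) (\<lambda>xs. LEAST b. \<exists>a<Suc (hd xs). prod_encode (a, b) = hd xs)"
  proof (rule comp_fun_Least)
    show "comp_rel (Suc (Suc 0)) (\<lambda>ys. \<exists>a<Suc (hd (tl ys)). prod_encode (a, hd ys) = hd (tl ys))"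
      by (intro computability)
    show "\<exists>b. \<exists>a<Suc (hd xs). prod_encode (a, b) = hd xs" for xs
      by (metis less_Suc_eq_le prod.collapse prod_decode_inverse pfst_le)
  qed
  ultimately have "comp_fun (Suc 0) (\<lambda>xs. psnd (hd xs))" by simp
  then show ?thesis using assms by (rule comp_fun_subst1)
qed

text \<open>
  A bounded arithmetical form: \<open>a\<close> and \<open>b\<close> are the binary digits of \<open>n\<close> above and below
  position \<open>x\<close>.
\<close>
lemma in_set_decode_iff_bounded:
  "x \<in> set_decode n \<longleftrightarrow> (\<exists>a<Suc n. \<exists>b<2 ^ x. n = Suc (2 * a) * 2 ^ x + b)"
proof
  assume "x \<in> set_decode n"
  then have "odd (n div 2 ^ x)" by (simp add: set_decode_def)
  then obtain a where a: "n div 2 ^ x = Suc (2 * a)" by (auto elim: oddE)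
  have "n = Suc (2 * a) * 2 ^ x + n mod 2 ^ x" using div_mult_mod_eq[of n "2 ^ x"] a by simp
  moreover have "a < Suc n" using a div_le_dividend[of n "2 ^ x"] by simp
  ultimately show "\<exists>a<Suc n. \<exists>b<2 ^ x. n = Suc (2 * a) * 2 ^ x + b"
    by (metis mod_less_divisor zero_less_numeral zero_less_power)
next
  assume "\<exists>a<Suc n. \<exists>b<2 ^ x. n = Suc (2 * a) * 2 ^ x + b"
  then obtain a b where "b < 2 ^ x" "n = Suc (2 * a) * 2 ^ x + b" by blast
  then have "n div 2 ^ x = Suc (2 * a)" by (simp only: div_mult_self3) simp
  then show "x \<in> set_decode n" by (simp add: set_decode_def)
qed

lemma comp_rel_in_set_decode [computability]:
  assumes "comp_fun n f" "comp_fun n g"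
  shows "comp_rel n (\<lambda>xs. f xs \<in> set_decode (g xs))"
  unfolding in_set_decode_iff_bounded by (intro computability assms)

lemma in_set_decode_less: "x \<in> set_decode n \<Longrightarrow> x < n"
proof -
  assume "x \<in> set_decode n"
  then have "2 ^ x \<le> n"
    unfolding in_set_decode_iff_bounded by (metis One_nat_def Suc_le_mono le_add1 le_trans mult_le_mono1 nat_mult_1 zero_le)
  then show ?thesis using less_exp[of x] by linarith
qed

lemma comp_rel_subset [computability]:
  assumes "comp_fun n f" "comp_fun n g"
  shows "comp_rel n (\<lambda>xs. set_decode (f xs) \<subseteq> set_decode (g xs))"
proof -
  have "comp_rel n (\<lambda>xs. \<forall>x<f xs. x \<in> set_decode (f xs) \<longrightarrow> x \<in> set_decode (g xs))"
    by (intro computability assms)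
  then show ?thesis by (rule comp_rel_cong) (auto dest: in_set_decode_less)
qed

section \<open>Course-of-values recursion\<close>

lemma pfst_psnd_less:
  assumes "0 < pfst c"
  shows "psnd c < c" "pfst (psnd c) < c" "psnd (psnd c) < c"
proof -
  have "triangle (pfst c + psnd c) + pfst c = c"
    using prod_decode_inverse[of c] by (simp add: prod_encode_def split_beta)
  moreover have "n \<le> triangle n" for n by (induction n) auto
  then have "pfst c + psnd c \<le> triangle (pfst c + psnd c)" .
  ultimately show "psnd c < c" using assms by linarith
  then show "pfst (psnd c) < c" "psnd (psnd c) < c"
    using pfst_le[of "psnd c"] psnd_le[of "psnd c"] by linarith+
qed

lemma prod_encode_mono:
  assumes "a \<le> a'" and "b \<le> b'"
  shows "prod_encode (a, b) \<le> prod_encode (a', b')"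
proof -
  have "triangle m \<le> triangle n" if "m \<le> n" for m n
    using that by (induction rule: dec_induct) auto
  then show ?thesis using assms by (simp add: prod_encode_def add_mono)
qed

lemma inj_set_decode: "inj set_decode"
  by (rule inj_on_inverseI[of _ set_encode]) (rule set_decode_inverse)

lemma set_decode_empty_iff: "set_decode n = {} \<longleftrightarrow> n = 0"
  using inj_eq[OF inj_set_decode, of n 0] by simp

lemma set_encode_less:
  assumes "S \<subseteq> {..<n}"
  shows "set_encode S < 2 ^ n"
proof -
  have "set_encode S \<le> (\<Sum>i<n. 2 ^ i)"
    unfolding set_encode_def using assms by (intro sum_mono2) auto
  also have "\<dots> < 2 ^ n" by (induction n) auto
  finally show ?thesis .
qed

lemma set_encode_le_if_subset:
  assumes "set_decode m \<subseteq> set_decode n"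
  shows "m \<le> n"
proof -
  have "set_encode (set_decode m) \<le> set_encode (set_decode n)"
    unfolding set_encode_def using assms by (intro sum_mono2) (auto intro: finite_set_decode)
  then show ?thesis by simp
qed

text \<open>
  The recursion runs over \<open>c\<close>. The value at \<open>(c, x)\<close> is computed by \<open>G\<close> from a table \<open>T\<close> of
  the values at smaller \<open>c'\<close>, where \<open>x\<close> may be replaced by any number that is at most \<open>x\<close> or
  at most the fixed parameter \<open>q\<close>. All second arguments met in the recursion are at most
  \<open>x + q\<close>, so there is a table below an explicit bound, and any table that satisfies the
  recursion up to \<open>c\<close> is correct up to \<open>c\<close>.
\<close>
lemma comp_rel_course_of_values:
  fixes P :: "nat \<Rightarrow> nat \<Rightarrow> nat \<Rightarrow> bool"
  assumes G: "comp_rel (Suc (Suc (Suc (Suc 0))))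
      (\<lambda>xs. G (hd xs) (hd (tl xs)) (hd (tl (tl xs))) (hd (tl (tl (tl xs)))))"
    and eq: "\<And>T c x q.
      (\<And>c' x'. c' < c \<Longrightarrow> x' \<le> x \<or> x' \<le> q \<Longrightarrow> prod_encode (c', x') \<in> set_decode T \<longleftrightarrow> P c' x' q) \<Longrightarrow>
      P c x q \<longleftrightarrow> G T c x q"
    and fgh: "comp_fun n f" "comp_fun n g" "comp_fun n h"
  shows "comp_rel n (\<lambda>xs. P (f xs) (g xs) (h xs))"
proof -
  let ?table = "\<lambda>T c x q. \<forall>c'<Suc c. \<forall>x'<Suc (x + q).
      prod_encode (c', x') \<in> set_decode T \<longleftrightarrow> G T c' x' q"
  have iff: "P c x q \<longleftrightarrow> (\<exists>T<2 ^ Suc (prod_encode (c, x + q)).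
      ?table T c x q \<and> prod_encode (c, x) \<in> set_decode T)" for c x q
  proof
    assume P: "P c x q"
    define A where "A = {prod_encode (c', x') | c' x'. c' \<le> c \<and> x' \<le> x + q \<and> P c' x' q}"
    have A: "A \<subseteq> {..<Suc (prod_encode (c, x + q))}"
      by (auto simp: A_def less_Suc_eq_le intro: prod_encode_mono)
    then have "finite A" by (rule finite_subset) simp
    define T where "T = set_encode A"
    have T: "prod_encode (c', x') \<in> set_decode T \<longleftrightarrow> P c' x' q" if "c' \<le> c" "x' \<le> x + q" for c' x'
      using that \<open>finite A\<close> by (auto simp: T_def A_def)
    have "P c' x' q \<longleftrightarrow> G T c' x' q" if "c' \<le> c" "x' \<le> x + q" for c' x'
      using that by (intro eq T) auto
    with T have "?table T c x q" by (simp add: less_Suc_eq_le)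
    moreover have "T < 2 ^ Suc (prod_encode (c, x + q))"
      unfolding T_def using A by (rule set_encode_less)
    moreover have "prod_encode (c, x) \<in> set_decode T" using P T by simp
    ultimately show "\<exists>T<2 ^ Suc (prod_encode (c, x + q)).
        ?table T c x q \<and> prod_encode (c, x) \<in> set_decode T" by blast
  next
    assume "\<exists>T<2 ^ Suc (prod_encode (c, x + q)).
        ?table T c x q \<and> prod_encode (c, x) \<in> set_decode T"
    then obtain T where T: "?table T c x q" and root: "prod_encode (c, x) \<in> set_decode T" by blast
    have "prod_encode (c', x') \<in> set_decode T \<longleftrightarrow> P c' x' q" if "c' \<le> c" "x' \<le> x + q" for c' x'
      using that
    proof (induction c' arbitrary: x' rule: less_induct)
      case (less c')
      have "P c' x' q \<longleftrightarrow> G T c' x' q"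
        using less.prems by (intro eq less.IH) auto
      then show ?case using T less.prems by (simp add: less_Suc_eq_le)
    qed
    then show "P c x q" using root by simp
  qed
  have "comp_rel (Suc (Suc (Suc 0))) (\<lambda>xs. P (hd xs) (hd (tl xs)) (hd (tl (tl xs))))"
    unfolding iff by (intro computability comp_rel_subst4[OF G])
  then show ?thesis using fgh by (rule comp_rel_subst3)
qed

section \<open>Recursive recognition of universal sentences\<close>

text \<open>
  Decoding is total, with \<open>Zero\<close> for all numbers that match no other clause. The codes of
  terms are then recognized by \<open>trm_code (trm_of c) = c\<close>.
\<close>
function trm_of :: "nat \<Rightarrow> trm" where
  "trm_of c =
     (if pfst c = 0 then Var (psnd c)
      else if pfst c = 2 then One
      else if pfst c = 3 then Neg (trm_of (psnd c))
      else if pfst c = 4 then Meet (trm_of (pfst (psnd c))) (trm_of (psnd (psnd c)))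
      else if pfst c = 5 then Join (trm_of (pfst (psnd c))) (trm_of (psnd (psnd c)))
      else Zero)"
  by auto
termination by (relation "measure id") (simp_all add: pfst_psnd_less)

text \<open>
  There is no clause for \<open>FEx\<close>, whose tag does not occur in codes of universal sentences.
\<close>
function fm_of :: "nat \<Rightarrow> fm" where
  "fm_of c =
     (if pfst c = 0 then FEq (trm_of (pfst (psnd c))) (trm_of (psnd (psnd c)))
      else if pfst c = 1 then FNot (fm_of (psnd c))
      else if pfst c = 2 then FAnd (fm_of (pfst (psnd c))) (fm_of (psnd (psnd c)))
      else if pfst c = 3 then FOr (fm_of (pfst (psnd c))) (fm_of (psnd (psnd c)))
      else if pfst c = 4 then FImp (fm_of (pfst (psnd c))) (fm_of (psnd (psnd c)))
      else if pfst c = 5 then FAll (pfst (psnd c)) (fm_of (psnd (psnd c)))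
      else FEq Zero Zero)"
  by auto
termination by (relation "measure id") (simp_all add: pfst_psnd_less)

declare trm_of.simps [simp del] fm_of.simps [simp del]

lemma trm_of_trm_code: "trm_of (trm_code t) = t"
  by (induction t) (simp_all add: trm_of.simps)

lemma fm_of_fm_code: "quantifier_free p \<Longrightarrow> fm_of (fm_code (foldr FAll xs p)) = foldr FAll xs p"
proof (induction xs)
  case Nil
  then show ?case
    by (induction p) (simp_all add: fm_of.simps[of "prod_encode _"] trm_of_trm_code)
qed (simp add: fm_of.simps[of "prod_encode _"])

definition is_term :: "nat \<Rightarrow> bool" where
  "is_term c \<longleftrightarrow> trm_code (trm_of c) = c"

definition is_qf :: "nat \<Rightarrow> bool" where
  "is_qf c \<longleftrightarrow> fm_code (fm_of c) = c \<and> quantifier_free (fm_of c)"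

definition is_universal :: "nat \<Rightarrow> bool" where
  "is_universal c \<longleftrightarrow> fm_code (fm_of c) = c \<and> (\<exists>xs p. quantifier_free p \<and> fm_of c = foldr FAll xs p)"

lemma prod_encode_eq_iff: "prod_encode (a, b) = c \<longleftrightarrow> pfst c = a \<and> psnd c = b"
proof
  show "prod_encode (a, b) = c" if "pfst c = a \<and> psnd c = b"
    using that prod_decode_inverse[of c] by (metis prod.collapse)
qed auto

lemma eq_prod_encode_iff: "c = prod_encode (a, b) \<longleftrightarrow> pfst c = a \<and> psnd c = b"
  using prod_encode_eq_iff by (metis)

lemma is_term_rec:
  "is_term c \<longleftrightarrow> pfst c = 0 \<or> (pfst c = 1 \<or> pfst c = 2) \<and> psnd c = 0 \<or>
     pfst c = 3 \<and> is_term (psnd c) \<or>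
     (pfst c = 4 \<or> pfst c = 5) \<and> is_term (pfst (psnd c)) \<and> is_term (psnd (psnd c))"
  unfolding is_term_def trm_of.simps[of c] by (auto simp: prod_encode_eq_iff eq_prod_encode_iff)

lemma is_qf_rec:
  "is_qf c \<longleftrightarrow> pfst c = 0 \<and> is_term (pfst (psnd c)) \<and> is_term (psnd (psnd c)) \<or>
     pfst c = 1 \<and> is_qf (psnd c) \<or>
     (pfst c = 2 \<or> pfst c = 3 \<or> pfst c = 4) \<and> is_qf (pfst (psnd c)) \<and> is_qf (psnd (psnd c))"
  unfolding is_qf_def is_term_def fm_of.simps[of c] by (auto simp: prod_encode_eq_iff eq_prod_encode_iff)

lemma is_universal_rec:
  "is_universal c \<longleftrightarrow> is_qf c \<or> pfst c = 5 \<and> is_universal (psnd (psnd c))"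
proof
  assume c: "is_universal c"
  then obtain xs p where p: "quantifier_free p" "fm_of c = foldr FAll xs p" "fm_code (fm_of c) = c"
    by (auto simp: is_universal_def)
  show "is_qf c \<or> pfst c = 5 \<and> is_universal (psnd (psnd c))"
  proof (cases xs)
    case Nil
    then show ?thesis using p by (simp add: is_qf_def)
  next
    case (Cons i ys)
    then have c: "c = prod_encode (5, prod_encode (i, fm_code (foldr FAll ys p)))"
      using p by simp
    then show ?thesis using fm_of_fm_code[OF p(1), of ys] p(1) by (auto simp: is_universal_def)
  qed
next
  assume "is_qf c \<or> pfst c = 5 \<and> is_universal (psnd (psnd c))"
  then show "is_universal c"
  proof
    assume "is_qf c"
    then show ?thesis by (auto simp: is_qf_def is_universal_def intro: exI[of _ "[]"])
  next
    assume c: "pfst c = 5 \<and> is_universal (psnd (psnd c))"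
    then obtain xs p where p: "quantifier_free p" "fm_of (psnd (psnd c)) = foldr FAll xs p"
      "fm_code (fm_of (psnd (psnd c))) = psnd (psnd c)" by (auto simp: is_universal_def)
    have fm: "fm_of c = FAll (pfst (psnd c)) (fm_of (psnd (psnd c)))"
      using c by (subst fm_of.simps) simp
    then have "fm_of c = foldr FAll (pfst (psnd c) # xs) p" using p by simp
    moreover have "fm_code (fm_of c) = c" using c p(3) fm by (simp add: prod_encode_eq_iff)
    ultimately show ?thesis using p(1) unfolding is_universal_def by blast
  qed
qed

definition occurs :: "nat \<Rightarrow> nat \<Rightarrow> bool" where
  "occurs c i \<longleftrightarrow> i \<in> trm_vars (trm_of c)"

definition occurs_free :: "nat \<Rightarrow> nat \<Rightarrow> bool" where
  "occurs_free c i \<longleftrightarrow> i \<in> free_vars (fm_of c)"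

lemma occurs_rec:
  "occurs c i \<longleftrightarrow> pfst c = 0 \<and> psnd c = i \<or> pfst c = 3 \<and> occurs (psnd c) i \<or>
     (pfst c = 4 \<or> pfst c = 5) \<and> (occurs (pfst (psnd c)) i \<or> occurs (psnd (psnd c)) i)"
  unfolding occurs_def by (subst trm_of.simps) auto

lemma occurs_free_rec:
  "occurs_free c i \<longleftrightarrow> pfst c = 0 \<and> (occurs (pfst (psnd c)) i \<or> occurs (psnd (psnd c)) i) \<or>
     pfst c = 1 \<and> occurs_free (psnd c) i \<or>
     (pfst c = 2 \<or> pfst c = 3 \<or> pfst c = 4) \<and>
       (occurs_free (pfst (psnd c)) i \<or> occurs_free (psnd (psnd c)) i) \<or>
     pfst c = 5 \<and> i \<noteq> pfst (psnd c) \<and> occurs_free (psnd (psnd c)) i"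
  unfolding occurs_free_def occurs_def by (subst fm_of.simps) auto

lemma comp_rel_is_term:
  assumes "comp_fun n f"
  shows "comp_rel n (\<lambda>xs. is_term (f xs))"
proof (rule comp_rel_course_of_values[where P = "\<lambda>c x q. is_term c" and g = "\<lambda>_. 0" and h = "\<lambda>_. 0"])
  let ?t = "\<lambda>T c. prod_encode (c, 0) \<in> set_decode T"
  let ?G = "\<lambda>T c. pfst c = 0 \<or> (pfst c = 1 \<or> pfst c = 2) \<and> psnd c = 0 \<or> pfst c = 3 \<and> ?t T (psnd c) \<or>
     (pfst c = 4 \<or> pfst c = 5) \<and> ?t T (pfst (psnd c)) \<and> ?t T (psnd (psnd c))"
  show "comp_rel (Suc (Suc (Suc (Suc 0)))) (\<lambda>xs. ?G (hd xs) (hd (tl xs)))"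
    by (intro computability)
  show "is_term c \<longleftrightarrow> ?G T c"
    if "\<And>c' x'. c' < c \<Longrightarrow> x' \<le> x \<or> x' \<le> q \<Longrightarrow> prod_encode (c', x') \<in> set_decode T \<longleftrightarrow> is_term c'"
    for T c x q
    using that pfst_psnd_less[of c] by (subst is_term_rec) (cases "pfst c = 0"; simp)
qed (intro computability assms)+

lemma comp_rel_is_qf:
  assumes "comp_fun n f"
  shows "comp_rel n (\<lambda>xs. is_qf (f xs))"
proof (rule comp_rel_course_of_values[where P = "\<lambda>c x q. is_qf c" and g = "\<lambda>_. 0" and h = "\<lambda>_. 0"])
  let ?t = "\<lambda>T c. prod_encode (c, 0) \<in> set_decode T"
  let ?G = "\<lambda>T c. pfst c = 0 \<and> is_term (pfst (psnd c)) \<and> is_term (psnd (psnd c)) \<or>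
     pfst c = 1 \<and> ?t T (psnd c) \<or>
     (pfst c = 2 \<or> pfst c = 3 \<or> pfst c = 4) \<and> ?t T (pfst (psnd c)) \<and> ?t T (psnd (psnd c))"
  show "comp_rel (Suc (Suc (Suc (Suc 0)))) (\<lambda>xs. ?G (hd xs) (hd (tl xs)))"
    by (intro computability comp_rel_is_term)
  show "is_qf c \<longleftrightarrow> ?G T c"
    if "\<And>c' x'. c' < c \<Longrightarrow> x' \<le> x \<or> x' \<le> q \<Longrightarrow> prod_encode (c', x') \<in> set_decode T \<longleftrightarrow> is_qf c'"
    for T c x q
    using that pfst_psnd_less[of c] by (subst is_qf_rec) (cases "pfst c = 0"; simp)
qed (intro computability assms)+

lemma comp_rel_is_universal:
  assumes "comp_fun n f"
  shows "comp_rel n (\<lambda>xs. is_universal (f xs))"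
proof (rule comp_rel_course_of_values[where P = "\<lambda>c x q. is_universal c" and g = "\<lambda>_. 0" and h = "\<lambda>_. 0"])
  let ?G = "\<lambda>T c. is_qf c \<or> pfst c = 5 \<and> prod_encode (psnd (psnd c), 0) \<in> set_decode T"
  show "comp_rel (Suc (Suc (Suc (Suc 0)))) (\<lambda>xs. ?G (hd xs) (hd (tl xs)))"
    by (intro computability comp_rel_is_qf)
  show "is_universal c \<longleftrightarrow> ?G T c"
    if "\<And>c' x'. c' < c \<Longrightarrow> x' \<le> x \<or> x' \<le> q \<Longrightarrow> prod_encode (c', x') \<in> set_decode T \<longleftrightarrow> is_universal c'"
    for T c x q
    using that pfst_psnd_less[of c] by (subst is_universal_rec) (cases "pfst c = 0"; simp)
qed (intro computability assms)+

lemma comp_rel_occurs: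
  assumes "comp_fun n f" "comp_fun n g"
  shows "comp_rel n (\<lambda>xs. occurs (f xs) (g xs))"
proof (rule comp_rel_course_of_values[where P = "\<lambda>c x q. occurs c x" and h = "\<lambda>_. 0"])
  let ?t = "\<lambda>T c i. prod_encode (c, i) \<in> set_decode T"
  let ?G = "\<lambda>T c i. pfst c = 0 \<and> psnd c = i \<or> pfst c = 3 \<and> ?t T (psnd c) i \<or>
     (pfst c = 4 \<or> pfst c = 5) \<and> (?t T (pfst (psnd c)) i \<or> ?t T (psnd (psnd c)) i)"
  show "comp_rel (Suc (Suc (Suc (Suc 0)))) (\<lambda>xs. ?G (hd xs) (hd (tl xs)) (hd (tl (tl xs))))"
    by (intro computability)
  show "occurs c x \<longleftrightarrow> ?G T c x"
    if "\<And>c' x'. c' < c \<Longrightarrow> x' \<le> x \<or> x' \<le> q \<Longrightarrow> prod_encode (c', x') \<in> set_decode T \<longleftrightarrow> occurs c' x'"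
    for T c x q
    using that pfst_psnd_less[of c] by (subst occurs_rec) (cases "pfst c = 0"; simp)
qed (intro computability assms)+

lemma comp_rel_occurs_free:
  assumes "comp_fun n f" "comp_fun n g"
  shows "comp_rel n (\<lambda>xs. occurs_free (f xs) (g xs))"
proof (rule comp_rel_course_of_values[where P = "\<lambda>c x q. occurs_free c x" and h = "\<lambda>_. 0"])
  let ?t = "\<lambda>T c i. prod_encode (c, i) \<in> set_decode T"
  let ?G = "\<lambda>T c i. pfst c = 0 \<and> (occurs (pfst (psnd c)) i \<or> occurs (psnd (psnd c)) i) \<or>
     pfst c = 1 \<and> ?t T (psnd c) i \<or>
     (pfst c = 2 \<or> pfst c = 3 \<or> pfst c = 4) \<and> (?t T (pfst (psnd c)) i \<or> ?t T (psnd (psnd c)) i) \<or>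
     pfst c = 5 \<and> i \<noteq> pfst (psnd c) \<and> ?t T (psnd (psnd c)) i"
  show "comp_rel (Suc (Suc (Suc (Suc 0)))) (\<lambda>xs. ?G (hd xs) (hd (tl xs)) (hd (tl (tl xs))))"
    by (intro computability comp_rel_occurs)
  show "occurs_free c x \<longleftrightarrow> ?G T c x"
    if "\<And>c' x'. c' < c \<Longrightarrow> x' \<le> x \<or> x' \<le> q \<Longrightarrow>
        prod_encode (c', x') \<in> set_decode T \<longleftrightarrow> occurs_free c' x'"
    for T c x q
    using that pfst_psnd_less[of c] by (subst occurs_free_rec) (cases "pfst c = 0"; simp)
qed (intro computability assms)+

section \<open>Coding finite sets of points\<close>

text \<open>
  The code of the maximal point \<open>(U, {U})\<close>, where \<open>U = set_decode u\<close>: the only binary digit 1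
  of \<open>2 ^ u\<close> is at position \<open>u\<close>.
\<close>
abbreviation max_code :: "nat \<Rightarrow> nat" where
  "max_code u \<equiv> prod_encode (u, 2 ^ u)"

definition set_set :: "nat \<Rightarrow> nat set set" where
  "set_set m = set_decode ` set_decode m"

definition point :: "nat \<Rightarrow> nat set \<times> nat set set" where
  "point n = (set_decode (pfst n), set_set (psnd n))"

definition point_set :: "nat \<Rightarrow> (nat set \<times> nat set set) set" where
  "point_set q = point ` set_decode q"

lemma set_decode_power: "set_decode (2 ^ u) = {u}"
  using set_encode_inverse[of "{u}"] by (simp add: set_encode_def)

lemma set_set_subset_iff: "set_set m \<subseteq> set_set n \<longleftrightarrow> set_decode m \<subseteq> set_decode n"
  unfolding set_set_def by (rule inj_image_subset_iff[OF inj_set_decode])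

lemma set_set_empty_iff: "set_set m = {} \<longleftrightarrow> m = 0"
  by (simp add: set_set_def set_decode_empty_iff)

lemma inj_set_set: "inj set_set"
  by (rule injI) (metis set_set_subset_iff inj_eq[OF inj_set_decode] order_refl subset_antisym)

lemma inj_point: "inj point"
proof (rule injI)
  fix m n
  assume "point m = point n"
  then have "pfst m = pfst n" "psnd m = psnd n"
    using inj_set_decode inj_set_set by (auto simp: point_def dest: injD)
  then show "m = n" using prod_decode_inverse by (metis prod.collapse)
qed

lemma point_in_point_set: "point n \<in> point_set q \<longleftrightarrow> n \<in> set_decode q"
  unfolding point_set_def by (rule inj_image_mem_iff[OF inj_point])

lemma point_prod_encode: "point (prod_encode (u, m)) = (set_decode u, set_set m)"
  by (simp add: point_def)

lemma point_max_code: "point (max_code u) = (set_decode u, {set_decode u})"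
  by (simp add: point_def set_set_def set_decode_power)

lemma finite_point_set: "finite (point_set q)"
  by (simp add: point_set_def)

lemma maximal_in_point_set_iff:
  "(set_decode u, {set_decode u}) \<in> point_set q \<longleftrightarrow> max_code u \<in> set_decode q"
  using point_in_point_set[of "max_code u"] by (simp add: point_max_code)

lemma pair_in_point_set_iff:
  "(Z, set_set s) \<in> point_set q \<longleftrightarrow> (\<exists>z<q. Z = set_decode z \<and> prod_encode (z, s) \<in> set_decode q)"
proof
  assume "(Z, set_set s) \<in> point_set q"
  then obtain n where n: "n \<in> set_decode q" "Z = set_decode (pfst n)" "set_set s = set_set (psnd n)"
    by (auto simp: point_set_def point_def)
  then have "prod_encode (pfst n, s) \<in> set_decode q" using injD[OF inj_set_set n(3)] by simp
  moreover have "pfst n < q" using in_set_decode_less[OF n(1)] pfst_le[of n] by linarith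
  ultimately show "\<exists>z<q. Z = set_decode z \<and> prod_encode (z, s) \<in> set_decode q" using n(2) by blast
next
  assume "\<exists>z<q. Z = set_decode z \<and> prod_encode (z, s) \<in> set_decode q"
  then show "(Z, set_set s) \<in> point_set q"
    using point_in_point_set by (auto simp: point_prod_encode[symmetric])
qed

lemma maximal_sets_coded:
  assumes "\<forall>U\<in>S. (U, {U}) \<in> point_set q"
  shows "\<exists>s<2 ^ q. S = set_set s"
proof -
  define T where "T = {u. set_decode u \<in> S}"
  have "u < q" if "u \<in> T" for u
  proof -
    have "max_code u \<in> set_decode q"
      using assms that by (simp add: T_def maximal_in_point_set_iff[symmetric])
    then show ?thesis using in_set_decode_less le_prod_encode_1[of u "2 ^ u"] by fastforce
  qed
  then have T: "T \<subseteq> {..<q}" by blast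
  then have "finite T" by (rule finite_subset) simp
  have "S \<subseteq> range set_decode"
    using assms by (auto simp: point_set_def point_def)
  then have "S = set_set (set_encode T)"
    using \<open>finite T\<close> by (auto simp: set_set_def T_def)
  then show ?thesis using set_encode_less[OF T] by blast
qed

lemma subset_point_set_coded:
  assumes "F \<subseteq> point_set q"
  shows "\<exists>f\<le>q. set_decode f \<subseteq> set_decode q \<and> F = point_set f"
proof -
  define T where "T = {n \<in> set_decode q. point n \<in> F}"
  have T: "T \<subseteq> set_decode q" "finite T" by (auto simp: T_def)
  then have "set_decode (set_encode T) \<subseteq> set_decode q" by simp
  moreover have "F = point_set (set_encode T)"
    using assms T(2) by (auto simp: T_def point_set_def)
  ultimately show ?thesis using set_encode_le_if_subset by blast
qed

lemma subset_set_set_coded: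
  assumes "S \<subseteq> set_set m"
  shows "\<exists>s\<le>m. set_decode s \<subseteq> set_decode m \<and> S = set_set s"
proof -
  define T where "T = {u \<in> set_decode m. set_decode u \<in> S}"
  have T: "T \<subseteq> set_decode m" "finite T" by (auto simp: T_def)
  then have "set_decode (set_encode T) \<subseteq> set_decode m" by simp
  moreover have "S = set_set (set_encode T)"
    using assms T(2) by (auto simp: T_def set_set_def)
  ultimately show ?thesis using set_encode_le_if_subset by blast
qed

text \<open>
  The condition \<open>realizable\<close> for the coded set, with every quantifier bounded. The bounds lose
  nothing: members of a coded set are smaller than its code, subsets have smaller or equal
  codes, and sets of maximal points of \<open>Q\<close> are coded below \<open>2 ^ q\<close> because
  \<open>u \<le> max_code u < q\<close>.
\<close>
definition realizable_code :: "nat \<Rightarrow> bool" where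
  "realizable_code q \<longleftrightarrow> 0 < q \<and>
     (\<forall>x<q. x \<in> set_decode q \<longrightarrow> 0 < psnd x \<and>
        (\<forall>u<psnd x. u \<in> set_decode (psnd x) \<longrightarrow>
           set_decode (pfst x) \<subseteq> set_decode u \<and> max_code u \<in> set_decode q)) \<and>
     (\<forall>s<2 ^ q. 0 < s \<longrightarrow> (\<forall>u<s. u \<in> set_decode s \<longrightarrow> max_code u \<in> set_decode q) \<longrightarrow>
        (\<exists>z<q. prod_encode (z, s) \<in> set_decode q \<and>
           (\<forall>x<q. x \<in> set_decode q \<longrightarrow> set_decode (psnd x) \<subseteq> set_decode s \<longrightarrow>
              set_decode z \<subseteq> set_decode (pfst x)))) \<and>
     (\<forall>x<q. x \<in> set_decode q \<longrightarrow>
        (\<exists>f<Suc q. set_decode f \<subseteq> set_decode q \<and> x \<in> set_decode f \<and>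
           (\<forall>s<Suc (psnd x). 0 < s \<longrightarrow> set_decode s \<subseteq> set_decode (psnd x) \<longrightarrow>
              (\<exists>w<f. prod_encode (w, s) \<in> set_decode f)) \<and>
           (\<forall>a<f. a \<in> set_decode f \<longrightarrow> (\<forall>b<f. b \<in> set_decode f \<longrightarrow>
              set_decode (psnd a) \<subseteq> set_decode (psnd b) \<longrightarrow>
              set_decode (pfst b) \<subseteq> set_decode (pfst a)))))"

lemma ball_less_set_decode: "(\<forall>x<q. x \<in> set_decode q \<longrightarrow> P x) \<longleftrightarrow> (\<forall>x\<in>set_decode q. P x)"
  using in_set_decode_less by blast

lemma ball_point_set: "(\<forall>x\<in>point_set q. P x) \<longleftrightarrow> (\<forall>x\<in>set_decode q. P (point x))"
  by (simp add: point_set_def)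

lemma fst_point: "fst (point x) = set_decode (pfst x)" and snd_point: "snd (point x) = set_set (psnd x)"
  by (simp_all add: point_def)

lemma realizable_code_iff: "realizable_code q \<longleftrightarrow> realizable (point_set q)"
proof -
  have 1: "0 < q \<longleftrightarrow> point_set q \<noteq> {}"
    using set_decode_empty_iff[of q] by (auto simp: point_set_def)
  have 2: "0 < psnd x \<and> (\<forall>u<psnd x. u \<in> set_decode (psnd x) \<longrightarrow>
           set_decode (pfst x) \<subseteq> set_decode u \<and> max_code u \<in> set_decode q) \<longleftrightarrow>
        point x \<in> points \<and> (\<forall>U\<in>snd (point x). (U, {U}) \<in> point_set q)" for x
    unfolding ball_less_set_decode points_iff fst_point snd_point set_set_empty_iff
    by (auto simp: set_set_def maximal_in_point_set_iff)
  have 3: "(\<forall>s<2 ^ q. 0 < s \<longrightarrow> (\<forall>u<s. u \<in> set_decode s \<longrightarrow> max_code u \<in> set_decode q) \<longrightarrow>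
        (\<exists>z<q. prod_encode (z, s) \<in> set_decode q \<and>
           (\<forall>x<q. x \<in> set_decode q \<longrightarrow> set_decode (psnd x) \<subseteq> set_decode s \<longrightarrow>
              set_decode z \<subseteq> set_decode (pfst x)))) \<longleftrightarrow>
      (\<forall>S. S \<noteq> {} \<longrightarrow> (\<forall>U\<in>S. (U, {U}) \<in> point_set q) \<longrightarrow>
        (\<exists>Z. (Z, S) \<in> point_set q \<and> (\<forall>x\<in>point_set q. snd x \<subseteq> S \<longrightarrow> Z \<subseteq> fst x)))"
    (is "(\<forall>s<2 ^ q. ?L s) \<longleftrightarrow> (\<forall>S. ?R S)")
  proof -
    have LR: "?L s \<longleftrightarrow> ?R (set_set s)" for s
    proof -
      have "(\<forall>U\<in>set_set s. (U, {U}) \<in> point_set q) \<longleftrightarrow> (\<forall>u\<in>set_decode s. max_code u \<in> set_decode q)"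
        by (simp add: set_set_def maximal_in_point_set_iff)
      moreover have "(\<exists>Z. (Z, set_set s) \<in> point_set q \<and> \<phi> Z) \<longleftrightarrow>
          (\<exists>z<q. prod_encode (z, s) \<in> set_decode q \<and> \<phi> (set_decode z))" for \<phi>
        unfolding pair_in_point_set_iff by blast
      ultimately show ?thesis
        unfolding ball_less_set_decode ball_point_set fst_point snd_point set_set_subset_iff
          set_set_empty_iff by simp
    qed
    show ?thesis
    proof
      assume L: "\<forall>s<2 ^ q. ?L s"
      show "\<forall>S. ?R S"
      proof (intro allI impI)
        fix S
        assume S: "S \<noteq> {}" "\<forall>U\<in>S. (U, {U}) \<in> point_set q"
        then obtain s where s: "s < 2 ^ q" "S = set_set s" using maximal_sets_coded by blast
        then have "?R (set_set s)" using L LR by blast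
        then show "\<exists>Z. (Z, S) \<in> point_set q \<and> (\<forall>x\<in>point_set q. snd x \<subseteq> S \<longrightarrow> Z \<subseteq> fst x)"
          using S s(2) by simp
      qed
    next
      assume R: "\<forall>S. ?R S"
      then show "\<forall>s<2 ^ q. ?L s" unfolding LR by (intro allI impI[of "_ < _"]) (rule spec)
    qed
  qed
  have 4: "(\<exists>f<Suc q. set_decode f \<subseteq> set_decode q \<and> x \<in> set_decode f \<and>
           (\<forall>s<Suc (psnd x). 0 < s \<longrightarrow> set_decode s \<subseteq> set_decode (psnd x) \<longrightarrow>
              (\<exists>w<f. prod_encode (w, s) \<in> set_decode f)) \<and>
           (\<forall>a<f. a \<in> set_decode f \<longrightarrow> (\<forall>b<f. b \<in> set_decode f \<longrightarrow>
              set_decode (psnd a) \<subseteq> set_decode (psnd b) \<longrightarrow>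
              set_decode (pfst b) \<subseteq> set_decode (pfst a)))) \<longleftrightarrow>
      (\<exists>F\<subseteq>point_set q. point x \<in> F \<and> (\<forall>S\<subseteq>snd (point x). S \<noteq> {} \<longrightarrow> (\<exists>W. (W, S) \<in> F)) \<and>
        (\<forall>a\<in>F. \<forall>b\<in>F. snd a \<subseteq> snd b \<longrightarrow> fst b \<subseteq> fst a))"
    (is "(\<exists>f<Suc q. ?sub f \<and> ?L f) \<longleftrightarrow> (\<exists>F\<subseteq>point_set q. ?R F)") for x
  proof -
    have "(\<forall>s<Suc (psnd x). 0 < s \<longrightarrow> set_decode s \<subseteq> set_decode (psnd x) \<longrightarrow>
          (\<exists>w<f. prod_encode (w, s) \<in> set_decode f)) \<longleftrightarrow>
        (\<forall>S\<subseteq>set_set (psnd x). S \<noteq> {} \<longrightarrow> (\<exists>W. (W, S) \<in> point_set f))" (is "?A \<longleftrightarrow> ?B") for f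
    proof -
      have ex: "(\<exists>w<f. prod_encode (w, s) \<in> set_decode f) \<longleftrightarrow> (\<exists>W. (W, set_set s) \<in> point_set f)" for s
        unfolding pair_in_point_set_iff by blast
      show ?thesis
      proof
        assume A: ?A
        show ?B
        proof (intro allI impI)
          fix S
          assume S: "S \<subseteq> set_set (psnd x)" "S \<noteq> {}"
          then obtain s where s: "s \<le> psnd x" "set_decode s \<subseteq> set_decode (psnd x)" "S = set_set s"
            using subset_set_set_coded by blast
          then have "0 < s" using S(2) set_set_empty_iff by (cases s) auto
          then show "\<exists>W. (W, S) \<in> point_set f" using A s ex by (simp add: less_Suc_eq_le)
        qed
      next
        assume B: ?B
        show ?A
        proof (intro allI impI)
          fix s
          assume "0 < s" "set_decode s \<subseteq> set_decode (psnd x)"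
          then have "set_set s \<subseteq> set_set (psnd x)" "set_set s \<noteq> {}"
            by (simp_all add: set_set_subset_iff set_set_empty_iff)
          then show "\<exists>w<f. prod_encode (w, s) \<in> set_decode f" unfolding ex using B by simp
        qed
      qed
    qed
    then have LR: "?L f \<longleftrightarrow> ?R (point_set f)" for f
      unfolding ball_less_set_decode ball_point_set fst_point snd_point set_set_subset_iff
        point_in_point_set by simp
    show ?thesis
    proof
      assume "\<exists>f<Suc q. ?sub f \<and> ?L f"
      then obtain f where f: "f < Suc q \<and> ?sub f \<and> ?L f" ..
      have "point_set f \<subseteq> point_set q"
        using conjunct1[OF conjunct2[OF f]] by (simp add: point_set_def image_mono)
      moreover have "?R (point_set f)" using conjunct2[OF conjunct2[OF f]] unfolding LR .
      ultimately show "\<exists>F\<subseteq>point_set q. ?R F" by (intro exI[of _ "point_set f"] conjI[of "_ \<subseteq> _"])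
    next
      assume "\<exists>F\<subseteq>point_set q. ?R F"
      then obtain F where F: "F \<subseteq> point_set q \<and> ?R F" ..
      obtain f where f: "f \<le> q" "?sub f" "F = point_set f"
        using subset_point_set_coded[OF conjunct1[OF F]] by (elim exE conjE)
      have "?L f" using conjunct2[OF F] unfolding LR f(3) .
      moreover have "f < Suc q" using f(1) by simp
      ultimately show "\<exists>f<Suc q. ?sub f \<and> ?L f"
        using f(2) by (intro exI[of _ f] conjI[of "_ < _"] conjI[of "_ \<subseteq> _"])
    qed
  qed
  show ?thesis
    unfolding realizable_code_def realizable_def 1 3
    by (simp only: 2 4 ball_less_set_decode[of q] ball_point_set[of q])
qed

lemma comp_rel_realizable_code:
  assumes "comp_fun n f"
  shows "comp_rel n (\<lambda>xs. realizable_code (f xs))"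
proof (rule comp_rel_subst1[OF _ assms])
  show "comp_rel (Suc 0) (\<lambda>xs. realizable_code (hd xs))"
    unfolding realizable_code_def by (intro computability)
qed

section \<open>Truth of a formula on a coded set of points\<close>

text \<open>
  Valuations whose maximal point is missing from \<open>Q\<close> are left out. For realizable \<open>Q\<close> this
  changes nothing, and for all other \<open>q\<close> it keeps the points met in the evaluation of a term
  below \<open>q\<close>, as the course-of-values recursion requires.
\<close>
definition point_in :: "nat \<Rightarrow> nat \<Rightarrow> nat set \<times> nat set set" where
  "point_in q x = (set_decode (pfst x),
     set_decode ` {u \<in> set_decode (psnd x). max_code u \<in> set_decode q})"

definition forces_code :: "nat \<Rightarrow> nat \<Rightarrow> nat \<Rightarrow> bool" where
  "forces_code c x q \<longleftrightarrow> forces (trm_of c) (point_in q x)"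

definition holds_code :: "nat \<Rightarrow> nat \<Rightarrow> bool" where
  "holds_code c q \<longleftrightarrow> holds_on (point_in q ` set_decode q) (fm_of c)"

lemma point_in_max_code:
  "max_code u \<in> set_decode q \<Longrightarrow> point_in q (max_code u) = (set_decode u, {set_decode u})"
  by (auto simp: point_in_def set_decode_power)

lemma forces_code_rec:
  "forces_code c x q \<longleftrightarrow> pfst c = 0 \<and> psnd c \<in> set_decode (pfst x) \<or> pfst c = 2 \<or>
     pfst c = 3 \<and> (\<forall>u<q. u \<in> set_decode (psnd x) \<longrightarrow> max_code u \<in> set_decode q \<longrightarrow>
       \<not> forces_code (psnd c) (max_code u) q) \<or>
     pfst c = 4 \<and> forces_code (pfst (psnd c)) x q \<and> forces_code (psnd (psnd c)) x q \<or>
     pfst c = 5 \<and> (forces_code (pfst (psnd c)) x q \<or> forces_code (psnd (psnd c)) x q)"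
proof (cases "pfst c = 3")
  case True
  have less: "u < q" if "max_code u \<in> set_decode q" for u
    using in_set_decode_less[OF that] le_prod_encode_1[of u "2 ^ u"] by linarith
  have "trm_of c = Neg (trm_of (psnd c))" using True by (simp add: trm_of.simps)
  then have "forces_code c x q \<longleftrightarrow> (\<forall>u\<in>set_decode (psnd x). max_code u \<in> set_decode q \<longrightarrow>
      \<not> forces (trm_of (psnd c)) (set_decode u, {set_decode u}))"
    by (auto simp: forces_code_def point_in_def[of q x])
  also have "\<dots> \<longleftrightarrow> (\<forall>u<q. u \<in> set_decode (psnd x) \<longrightarrow> max_code u \<in> set_decode q \<longrightarrow>
       \<not> forces_code (psnd c) (max_code u) q)"
    using less by (auto simp: forces_code_def point_in_max_code)
  finally show ?thesis using True by simp
next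
  case False
  then show ?thesis
    unfolding forces_code_def trm_of.simps[of c] by (auto simp: point_in_def)
qed

lemma holds_code_rec:
  "holds_code c q \<longleftrightarrow> pfst c = 0 \<and> (\<forall>x<q. x \<in> set_decode q \<longrightarrow>
       (forces_code (pfst (psnd c)) x q \<longleftrightarrow> forces_code (psnd (psnd c)) x q)) \<or>
     pfst c = 1 \<and> \<not> holds_code (psnd c) q \<or>
     pfst c = 2 \<and> holds_code (pfst (psnd c)) q \<and> holds_code (psnd (psnd c)) q \<or>
     pfst c = 3 \<and> (holds_code (pfst (psnd c)) q \<or> holds_code (psnd (psnd c)) q) \<or>
     pfst c = 4 \<and> (holds_code (pfst (psnd c)) q \<longrightarrow> holds_code (psnd (psnd c)) q) \<or>
     pfst c = 5 \<and> holds_code (psnd (psnd c)) q \<or> 5 < pfst c"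
  unfolding holds_code_def forces_code_def ball_less_set_decode fm_of.simps[of c] by auto

lemma comp_rel_forces_code:
  assumes "comp_fun n f" "comp_fun n g" "comp_fun n h"
  shows "comp_rel n (\<lambda>xs. forces_code (f xs) (g xs) (h xs))"
proof (rule comp_rel_course_of_values[where P = forces_code])
  let ?t = "\<lambda>T c x. prod_encode (c, x) \<in> set_decode T"
  let ?G = "\<lambda>T c x q. pfst c = 0 \<and> psnd c \<in> set_decode (pfst x) \<or> pfst c = 2 \<or>
     pfst c = 3 \<and> (\<forall>u<q. u \<in> set_decode (psnd x) \<longrightarrow> max_code u \<in> set_decode q \<longrightarrow>
       \<not> ?t T (psnd c) (max_code u)) \<or>
     pfst c = 4 \<and> ?t T (pfst (psnd c)) x \<and> ?t T (psnd (psnd c)) x \<or>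
     pfst c = 5 \<and> (?t T (pfst (psnd c)) x \<or> ?t T (psnd (psnd c)) x)"
  show "comp_rel (Suc (Suc (Suc (Suc 0))))
      (\<lambda>xs. ?G (hd xs) (hd (tl xs)) (hd (tl (tl xs))) (hd (tl (tl (tl xs)))))"
    by (intro computability)
  show "forces_code c x q \<longleftrightarrow> ?G T c x q"
    if t: "\<And>c' x'. c' < c \<Longrightarrow> x' \<le> x \<or> x' \<le> q \<Longrightarrow> ?t T c' x' \<longleftrightarrow> forces_code c' x' q" for T c x q
  proof (cases "pfst c = 0")
    case False
    then have less: "psnd c < c" "pfst (psnd c) < c" "psnd (psnd c) < c"
      using pfst_psnd_less by simp_all
    have "?t T (psnd c) (max_code u) \<longleftrightarrow> forces_code (psnd c) (max_code u) q"
      if "max_code u \<in> set_decode q" for u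
      using t[OF less(1)] in_set_decode_less[OF that] by simp
    then show ?thesis using False less t by (subst forces_code_rec) auto
  qed (subst forces_code_rec, simp)
qed (intro assms)+

lemma comp_rel_holds_code:
  assumes "comp_fun n f" "comp_fun n g"
  shows "comp_rel n (\<lambda>xs. holds_code (f xs) (g xs))"
proof (rule comp_rel_course_of_values[where P = "\<lambda>c x q. holds_code c q" and g = "\<lambda>_. 0"])
  let ?t = "\<lambda>T c. prod_encode (c, 0) \<in> set_decode T"
  let ?G = "\<lambda>T c q. pfst c = 0 \<and> (\<forall>x<q. x \<in> set_decode q \<longrightarrow>
       (forces_code (pfst (psnd c)) x q \<longleftrightarrow> forces_code (psnd (psnd c)) x q)) \<or>
     pfst c = 1 \<and> \<not> ?t T (psnd c) \<or>
     pfst c = 2 \<and> ?t T (pfst (psnd c)) \<and> ?t T (psnd (psnd c)) \<or>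
     pfst c = 3 \<and> (?t T (pfst (psnd c)) \<or> ?t T (psnd (psnd c))) \<or>
     pfst c = 4 \<and> (?t T (pfst (psnd c)) \<longrightarrow> ?t T (psnd (psnd c))) \<or>
     pfst c = 5 \<and> ?t T (psnd (psnd c)) \<or> 5 < pfst c"
  show "comp_rel (Suc (Suc (Suc (Suc 0)))) (\<lambda>xs. ?G (hd xs) (hd (tl xs)) (hd (tl (tl (tl xs)))))"
    by (intro computability comp_rel_forces_code)
  show "holds_code c q \<longleftrightarrow> ?G T c q"
    if "\<And>c' x'. c' < c \<Longrightarrow> x' \<le> x \<or> x' \<le> q \<Longrightarrow> prod_encode (c', x') \<in> set_decode T \<longleftrightarrow> holds_code c' q"
    for T c x q
    using that pfst_psnd_less[of c] by (subst holds_code_rec) (cases "pfst c = 0"; simp)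
qed (intro computability assms)+

lemma holds_code_iff:
  assumes "realizable_code q"
  shows "holds_code c q \<longleftrightarrow> holds_on (point_set q) (fm_of c)"
proof -
  have "point_in q x = point x" if "x \<in> set_decode q" for x
  proof -
    have "{u \<in> set_decode (psnd x). max_code u \<in> set_decode q} = set_decode (psnd x)"
      using assms that unfolding realizable_code_def ball_less_set_decode by auto
    then show ?thesis by (simp add: point_in_def point_def set_set_def)
  qed
  then show ?thesis by (simp add: holds_code_def point_set_def)
qed

text \<open>
  Over the variables up to \<open>c\<close>, valuations have codes below \<open>2 ^ Suc c\<close> and sets of valuations
  below \<open>2 ^ 2 ^ Suc c\<close>, which bounds the codes of points and hence of sets of points.
\<close>
abbreviation structure_bound :: "nat \<Rightarrow> nat" where
  "structure_bound c \<equiv> 2 ^ Suc (prod_encode (2 ^ Suc c, 2 ^ 2 ^ Suc c))"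

lemma point_set_coded:
  assumes Q: "Q \<subseteq> Pow {..<Suc c} \<times> Pow (Pow {..<Suc c})"
  shows "\<exists>q<structure_bound c. Q = point_set q"
proof -
  let ?b = "prod_encode (2 ^ Suc c, 2 ^ 2 ^ Suc c)"
  have set: "\<exists>u<2 ^ Suc c. U = set_decode u" if "U \<subseteq> {..<Suc c}" for U
  proof -
    have "finite U" using that by (rule finite_subset) simp
    then show ?thesis using set_encode_less[OF that] by (intro exI[of _ "set_encode U"]) simp
  qed
  have set_set: "\<exists>m<2 ^ 2 ^ Suc c. M = set_set m" if M: "M \<subseteq> Pow {..<Suc c}" for M
  proof -
    let ?T = "{u. u < 2 ^ Suc c \<and> set_decode u \<in> M}"
    have "M = set_decode ` ?T" using set M by blast
    then have "M = set_set (set_encode ?T)" by (simp add: set_set_def)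
    moreover have "set_encode ?T < 2 ^ 2 ^ Suc c" by (rule set_encode_less) auto
    ultimately show ?thesis by blast
  qed
  let ?T = "{n. n \<le> ?b \<and> point n \<in> Q}"
  have "\<exists>n\<in>?T. x = point n" if x: "x \<in> Q" for x
  proof -
    have "x \<in> Pow {..<Suc c} \<times> Pow (Pow {..<Suc c})" using x Q by (rule subsetD[rotated])
    then have fs: "fst x \<subseteq> {..<Suc c}" "snd x \<subseteq> Pow {..<Suc c}" by (simp_all only: mem_Times_iff Pow_iff)
    obtain u where u: "u < 2 ^ Suc c" "fst x = set_decode u" using set[OF fs(1)] by (elim exE conjE)
    obtain m where m: "m < 2 ^ 2 ^ Suc c" "snd x = set_set m"
      using set_set[OF fs(2)] by (elim exE conjE)
    have "x = point (prod_encode (u, m))" using u m by (simp add: point_prod_encode prod_eq_iff)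
    moreover have "prod_encode (u, m) \<le> ?b" using u m by (intro prod_encode_mono) simp_all
    ultimately show ?thesis using x by (intro bexI[of _ "prod_encode (u, m)"]) simp_all
  qed
  then have "Q = point ` ?T" by blast
  then have "Q = point_set (set_encode ?T)" by (simp add: point_set_def)
  moreover have "set_encode ?T < structure_bound c" by (rule set_encode_less) (auto simp: less_Suc_eq_le)
  ultimately show ?thesis by blast
qed

lemma trm_vars_le: "i \<in> trm_vars t \<Longrightarrow> i \<le> trm_code t"
  by (induction t) (auto intro: le_prod_encode_2 order_trans[OF _ le_prod_encode_2]
      order_trans[OF order_trans[OF _ le_prod_encode_1] le_prod_encode_2]
      order_trans[OF order_trans[OF _ le_prod_encode_2] le_prod_encode_2])

lemma free_vars_le: "i \<in> free_vars p \<Longrightarrow> i \<le> fm_code p"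
  by (induction p) (auto dest!: trm_vars_le intro: order_trans[OF _ le_prod_encode_2]
      order_trans[OF order_trans[OF _ le_prod_encode_1] le_prod_encode_2]
      order_trans[OF order_trans[OF _ le_prod_encode_2] le_prod_encode_2])

lemma fm_code_le_foldr: "fm_code p \<le> fm_code (foldr FAll xs p)"
  by (induction xs) (auto intro: order_trans[OF order_trans[OF _ le_prod_encode_2] le_prod_encode_2])

section \<open>The decision procedure\<close>

definition accepts :: "nat \<Rightarrow> bool" where
  "accepts c \<longleftrightarrow> is_universal c \<and> (\<forall>i<Suc c. \<not> occurs_free c i) \<and>
     (\<forall>q<structure_bound c. realizable_code q \<longrightarrow> holds_code c q)"

lemma comp_rel_accepts: "comp_rel (Suc 0) (\<lambda>xs. accepts (hd xs))"
  unfolding accepts_def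
  by (intro computability comp_rel_is_universal comp_rel_occurs_free comp_rel_realizable_code
      comp_rel_holds_code)

text \<open>
  Validity quantifies over all assignments, so the sentence is valid iff its matrix is. The
  variables of the matrix are at most the code of the sentence, so the sets within the bound
  suffice.
\<close>
lemma valid_in_free_pdl_iff:
  assumes p: "p = foldr FAll xs r" and r: "quantifier_free r"
  shows "valid_in free_pdl p \<longleftrightarrow>
    (\<forall>q<structure_bound (fm_code p). realizable_code q \<longrightarrow> holds_code (fm_code p) q)"
proof -
  have fm: "fm_of (fm_code p) = p" using p r fm_of_fm_code by simp
  have holds: "holds_code (fm_code p) q \<longleftrightarrow> holds_on (point_set q) r" if "realizable_code q" for q
    unfolding holds_code_iff[OF that] fm by (simp add: p)
  have "valid_in free_pdl p \<longleftrightarrow> valid_in free_pdl r" by (simp add: p valid_in_foldr_FAll)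
  also have "\<dots> \<longleftrightarrow> (\<forall>q<structure_bound (fm_code p). realizable_code q \<longrightarrow> holds_on (point_set q) r)"
  proof (intro iffI allI impI)
    show "holds_on (point_set q) r" if "valid_in free_pdl r" "realizable_code q" for q
      using holds_on_realizable_if_valid[OF that(1) r finite_point_set] that(2)
      by (simp add: realizable_code_iff)
  next
    assume all: "\<forall>q<structure_bound (fm_code p). realizable_code q \<longrightarrow> holds_on (point_set q) r"
    show "valid_in free_pdl r"
    proof (rule valid_if_holds_on_realizable[OF r, of "Suc (fm_code p)"])
      show "free_vars r \<subseteq> {..<Suc (fm_code p)}"
        using free_vars_le[of _ r] fm_code_le_foldr[of r xs] by (force simp: p less_Suc_eq_le)
      show "holds_on Q r" if "realizable Q" "Q \<subseteq> Pow {..<Suc (fm_code p)} \<times> Pow (Pow {..<Suc (fm_code p)})"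
        for Q
        using point_set_coded[OF that(2)] that(1) all by (auto simp: realizable_code_iff)
    qed
  qed
  finally show ?thesis using holds by simp
qed

lemma accepts_iff: "accepts c \<longleftrightarrow> c \<in> fm_code ` universal_theory free_pdl"
proof
  assume c: "accepts c"
  then obtain xs r where r: "quantifier_free r" "fm_of c = foldr FAll xs r" "fm_code (fm_of c) = c"
    by (auto simp: accepts_def is_universal_def)
  have "free_vars (fm_of c) = {}"
    using c free_vars_le[of _ "fm_of c"] r(3) by (auto simp: accepts_def occurs_free_def less_Suc_eq_le)
  then have "universal_sentence (fm_of c)" using r by (auto simp: universal_sentence_def sentence_def)
  moreover have "valid_in free_pdl (fm_of c)"
    using c valid_in_free_pdl_iff[OF r(2,1)] r(3) by (simp add: accepts_def)
  ultimately have "fm_of c \<in> universal_theory free_pdl" by (simp add: universal_theory_def)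
  then show "c \<in> fm_code ` universal_theory free_pdl" using r(3) by (metis image_eqI)
next
  assume "c \<in> fm_code ` universal_theory free_pdl"
  then obtain p where p: "c = fm_code p" "universal_sentence p" "valid_in free_pdl p"
    by (auto simp: universal_theory_def)
  then obtain xs r where r: "quantifier_free r" "p = foldr FAll xs r"
    by (auto simp: universal_sentence_def)
  have fm: "fm_of c = p" using p(1) r fm_of_fm_code by simp
  have "is_universal c" using fm p(1) r by (auto simp: is_universal_def)
  moreover have "\<not> occurs_free c i" for i
    using p(2) fm by (simp add: occurs_free_def universal_sentence_def sentence_def)
  ultimately show "accepts c"
    using p(1,3) valid_in_free_pdl_iff[OF r(2,1)] by (simp add: accepts_def)
qed

theorem theorem7p4: "decidable (universal_theory free_pdl)"
proof -
  obtain f where "recursive (Suc 0) f"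
    and "\<And>xs. length xs = Suc 0 \<Longrightarrow> f xs = (if accepts (hd xs) then 1 else 0)"
    using comp_rel_accepts unfolding comp_rel_def comp_fun_def by blast
  then show ?thesis
    unfolding decidable_def recursive_set_def
    by (intro exI[of _ f]) (simp add: accepts_iff)
qed

end
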